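(* Let $m\ge 1$ be an integer. Then: (i) for every even integer $r$ with $2m\le r\le 2m+18\lfloor m/3\rfloor$ there exists a strongly regular graph with parameters $P_0(m)$ and 2-rank $r$; (ii) for every even integer $r$ with $2m+2\le r\le 2m+2+18\lfloor m/3\rfloor$ there exists a strongly regular graph with parameters $P_+(m)$ and 2-rank $r$; (iii) for every even integer $r$ with $2m+2\le r\le 2m+2+18\lfloor m/3\rfloor$ there exists a strongly regular graph with parameters $P_-(m)$ and 2-rank $r$.
   Context: A strongly regular graph with parameters $(n,k,\lambda,\mu)$ is a $k$-regular graph on $n$ vertices in which any two adjacent vertices have exactly $\lambda$ common neighbours and any two distinct non-adjacent vertices have exactly $\mu$ common neighbours. $P_0(m)=(2^{2m}-1,\,2^{2m-1},\,2^{2m-2},\,2^{2m-2})$ and $P_\pm(m)=(2^{2m},\,2^{2m-1}\pm2^{m-1},\,2^{2m-2}\pm2^{m-1},\,2^{2m-2}\pm2^{m-1})$. The 2-rank of a graph is the rank over $\mathbb{F}_2$ of its adjacency matrix. *)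

theory Defs
  imports "HOL-Library.Z2" "Jordan_Normal_Form.DL_Rank"
begin

text \<open>Finite simple graphs on the vertex set {0..<n}, given by a symmetric,
irreflexive adjacency relation E (values outside the vertex set are irrelevant).\<close>

definition simple_graph :: "nat \<Rightarrow> (nat \<Rightarrow> nat \<Rightarrow> bool) \<Rightarrow> bool" where
  "simple_graph n E \<longleftrightarrow>
     (\<forall>u<n. \<forall>v<n. E u v \<longleftrightarrow> E v u) \<and> (\<forall>v<n. \<not> E v v)"

definition nbhd :: "nat \<Rightarrow> (nat \<Rightarrow> nat \<Rightarrow> bool) \<Rightarrow> nat \<Rightarrow> nat set" where
  "nbhd n E v = {u. u < n \<and> E v u}"

definition strongly_regular ::
  "nat \<Rightarrow> (nat \<Rightarrow> nat \<Rightarrow> bool) \<Rightarrow> nat \<Rightarrow> nat \<Rightarrow> nat \<Rightarrow> bool" where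
  "strongly_regular n E k lam mu \<longleftrightarrow>
     simple_graph n E \<and>
     (\<forall>v<n. card (nbhd n E v) = k) \<and>
     (\<forall>u<n. \<forall>v<n. u \<noteq> v \<and> E u v \<longrightarrow> card (nbhd n E u \<inter> nbhd n E v) = lam) \<and>
     (\<forall>u<n. \<forall>v<n. u \<noteq> v \<and> \<not> E u v \<longrightarrow> card (nbhd n E u \<inter> nbhd n E v) = mu)"

definition adj_mat_F2 :: "nat \<Rightarrow> (nat \<Rightarrow> nat \<Rightarrow> bool) \<Rightarrow> bit mat" where
  "adj_mat_F2 n E = mat n n (\<lambda>(i, j). if E i j then 1 else 0)"

definition two_rank :: "nat \<Rightarrow> (nat \<Rightarrow> nat \<Rightarrow> bool) \<Rightarrow> nat" where
  "two_rank n E = vec_space.rank n (adj_mat_F2 n E)"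

definition SRG_with_2rank :: "nat \<times> nat \<times> nat \<times> nat \<Rightarrow> nat \<Rightarrow> bool" where
  "SRG_with_2rank P r \<longleftrightarrow>
     (case P of (n, k, lam, mu) \<Rightarrow>
        \<exists>E. strongly_regular n E k lam mu \<and> two_rank n E = r)"

definition P0 :: "nat \<Rightarrow> nat \<times> nat \<times> nat \<times> nat" where
  "P0 m = (2^(2*m) - 1, 2^(2*m-1), 2^(2*m-2), 2^(2*m-2))"

definition Pplus :: "nat \<Rightarrow> nat \<times> nat \<times> nat \<times> nat" where
  "Pplus m = (2^(2*m), 2^(2*m-1) + 2^(m-1), 2^(2*m-2) + 2^(m-1), 2^(2*m-2) + 2^(m-1))"

definition Pminus :: "nat \<Rightarrow> nat \<times> nat \<times> nat \<times> nat" where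
  "Pminus m = (2^(2*m), 2^(2*m-1) - 2^(m-1), 2^(2*m-2) - 2^(m-1), 2^(2*m-2) - 2^(m-1))"

end

theory Submission
  imports Defs
begin

text \<open>
  A graph with parameters \<open>P\<^sub>\<plusminus>(m)\<close> is the same thing as a symmetric Hadamard matrix of order \<open>4\<^sup>m\<close> with
  constant diagonal \<open>1\<close> and constant row sum \<open>\<mp>2\<^sup>m\<close>; writing the entries as \<open>(-1)\<^bsup>f x y\<^esup>\<close> gives an
  alternating form \<open>f\<close> over the field with two elements. Switching \<open>f\<close> so that one vertex becomes
  isolated, and deleting that vertex, gives a graph with parameters \<open>P\<^sub>0(m)\<close>. If the all-one vector
  is a sum of rows of \<open>f\<close>, this lowers the 2-rank by exactly 2. The Kronecker product of Hadamard
  matrices corresponds to the direct sum of forms, the row sums multiply, and the 2-ranks of the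
  isolated forms add. So it suffices to treat \<open>m = 1\<close> (the graphs \<open>K\<^sub>4\<close> and \<open>2K\<^sub>2\<close>) and \<open>m = 3\<close>.

  For \<open>m = 3\<close> one starts from the symplectic graphs and applies a sequence of Godsil--McKay
  switchings at 4-sets. Each of them preserves the parameters and changes the 2-rank, which is
  even, by at most 2; since the last graph has 2-rank 26, all even values from 8 to 26 occur.
\<close>

subsection \<open>Row spaces\<close>

declare add_bit_eq_xor [simp del] mult_bit_eq_and [simp del]

lemma bit_add_self [simp]: "a + a = (0::bit)" "a + (a + b) = (b::bit)"
  by (cases a; cases b; simp)+

text \<open>Functions are extended by zero outside \<open>X\<close>, so that agreement on
  \<open>X\<close> is equality of functions and \<open>row_span\<close> is finite for finite
  \<open>X\<close>. Ranks are measured below by the number of elements of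
  \<open>row_span\<close>.\<close>

definition row_comb :: "'a set \<Rightarrow> ('a \<Rightarrow> 'a \<Rightarrow> bit) \<Rightarrow> 'a set \<Rightarrow> 'a \<Rightarrow> bit" where
  "row_comb X f A = (\<lambda>y. if y \<in> X then \<Sum>x\<in>A. f x y else 0)"

definition row_span :: "'a set \<Rightarrow> ('a \<Rightarrow> 'a \<Rightarrow> bit) \<Rightarrow> ('a \<Rightarrow> bit) set" where
  "row_span X f = row_comb X f ` Pow X"

text \<open>Over the field with two elements the only scalars are 0 and 1, so this already describes
  a subspace.\<close>

definition add_closed :: "('a \<Rightarrow> bit) set \<Rightarrow> bool" where
  "add_closed W \<longleftrightarrow> (\<lambda>_. 0) \<in> W \<and> (\<forall>u\<in>W. \<forall>v\<in>W. (\<lambda>y. u y + v y) \<in> W)"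

lemma add_closedD:
  assumes "add_closed W" "u \<in> W" "v \<in> W"
  shows "(\<lambda>y. u y + v y) \<in> W"
  using assms by (auto simp: add_closed_def)

lemma add_closed_scale:
  assumes "add_closed W" "u \<in> W"
  shows "(\<lambda>y. c * u y) \<in> W"
  using assms by (cases c) (auto simp: add_closed_def)

lemma add_closed_sum:
  assumes "add_closed W" "\<And>i. i \<in> I \<Longrightarrow> g i \<in> W"
  shows "(\<lambda>y. \<Sum>i\<in>I. g i y) \<in> W"
  using assms(2)
proof (induction I rule: infinite_finite_induct)
  case (insert i I)
  then have "(\<lambda>y. g i y + (\<Sum>i\<in>I. g i y)) \<in> W"
    using assms(1) by (auto intro!: add_closedD)
  with insert show ?case by simp
qed (use assms(1) in \<open>auto simp: add_closed_def\<close>)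

text \<open>Terms over the intersection occur twice and cancel in characteristic 2. Hence sums of
  rows are closed under addition.\<close>

lemma sum_sym_diff_bit:
  fixes g :: "'a \<Rightarrow> bit"
  assumes "finite A" "finite B"
  shows "(\<Sum>x\<in>A. g x) + (\<Sum>x\<in>B. g x) = (\<Sum>x\<in>(A - B) \<union> (B - A). g x)"
proof -
  have "(\<Sum>x\<in>A. g x) = (\<Sum>x\<in>A - B. g x) + (\<Sum>x\<in>A \<inter> B. g x)"
    using sum.Int_Diff[OF assms(1), of g B] by (simp add: add.commute)
  moreover have "(\<Sum>x\<in>B. g x) = (\<Sum>x\<in>B - A. g x) + (\<Sum>x\<in>A \<inter> B. g x)"
    using sum.Int_Diff[OF assms(2), of g A] by (simp add: add.commute Int_commute)
  moreover have "(\<Sum>x\<in>(A - B) \<union> (B - A). g x) = (\<Sum>x\<in>A - B. g x) + (\<Sum>x\<in>B - A. g x)"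
    using assms by (intro sum.union_disjoint) auto
  moreover have "(a + c) + (b + c) = a + b" for a b c :: bit
    by (cases a; cases b; cases c) simp_all
  ultimately show ?thesis by simp
qed

lemma row_span_outside: "w \<in> row_span X f \<Longrightarrow> y \<notin> X \<Longrightarrow> w y = 0"
  by (auto simp: row_span_def row_comb_def)

lemma finite_row_span: "finite X \<Longrightarrow> finite (row_span X f)"
  by (simp add: row_span_def)

lemma row_comb_in: "A \<subseteq> X \<Longrightarrow> row_comb X f A \<in> row_span X f"
  by (auto simp: row_span_def)

lemma add_closed_row_span:
  assumes "finite X"
  shows "add_closed (row_span X f)"
  unfolding add_closed_def
proof (intro conjI ballI)
  have "(\<lambda>_. 0) = row_comb X f {}" by (auto simp: row_comb_def)
  then show "(\<lambda>_. 0) \<in> row_span X f" using row_comb_in[of "{}" X f] by simp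
next
  fix u v assume "u \<in> row_span X f" "v \<in> row_span X f"
  then obtain A B where AB: "A \<subseteq> X" "B \<subseteq> X" "u = row_comb X f A" "v = row_comb X f B"
    by (auto simp: row_span_def)
  then have fin: "finite A" "finite B" using assms finite_subset by auto
  have "(\<lambda>y. u y + v y) = row_comb X f ((A - B) \<union> (B - A))"
    by (rule ext) (simp add: AB row_comb_def sum_sym_diff_bit[OF fin])
  then show "(\<lambda>y. u y + v y) \<in> row_span X f"
    using row_comb_in[of "(A - B) \<union> (B - A)" X f] AB by auto
qed

text \<open>Combinations of rows arise by addition alone, so it suffices to test the generators.
  Most inclusions between spans below are proved this way.\<close>

lemma row_span_subsetI:
  assumes "add_closed W" "\<And>x. x \<in> X \<Longrightarrow> (\<lambda>y. if y \<in> X then f x y else 0) \<in> W"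
  shows "row_span X f \<subseteq> W"
proof
  fix w assume "w \<in> row_span X f"
  then obtain A where A: "A \<subseteq> X" "w = row_comb X f A" by (auto simp: row_span_def)
  have "(\<lambda>y. \<Sum>x\<in>A. if y \<in> X then f x y else 0) \<in> W"
    using assms A by (intro add_closed_sum) auto
  also have "(\<lambda>y. \<Sum>x\<in>A. if y \<in> X then f x y else 0) = w"
    by (auto simp: A row_comb_def)
  finally show "w \<in> W" .
qed

lemma row_in_row_span: "x \<in> X \<Longrightarrow> (\<lambda>y. if y \<in> X then f x y else 0) \<in> row_span X f"
  using row_comb_in[of "{x}" X f] by (simp add: row_comb_def cong: if_cong)

lemma row_span_cong:
  assumes "\<And>x y. x \<in> X \<Longrightarrow> y \<in> X \<Longrightarrow> f x y = g x y"
  shows "row_span X f = row_span X g"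
  unfolding row_span_def
proof (rule image_cong[OF refl])
  fix A assume "A \<in> Pow X"
  then show "row_comb X f A = row_comb X g A"
    by (auto simp: row_comb_def fun_eq_iff intro!: sum.cong assms)
qed

lemma row_span_reindex:
  assumes h: "bij_betw h Y X"
  shows "card (row_span Y (\<lambda>i j. f (h i) (h j))) = card (row_span X f)"
proof -
  define g where "g = (\<lambda>(w :: 'b \<Rightarrow> bit) y. if y \<in> Y then w (h y) else 0)"
  have inj: "inj_on h Y" and im: "h ` Y = X" using h by (auto simp: bij_betw_def)
  have gA: "g (row_comb X f (h ` A)) = row_comb Y (\<lambda>i j. f (h i) (h j)) A" if "A \<subseteq> Y" for A
  proof -
    have "inj_on h A" using inj that inj_on_subset by blast
    then show ?thesis using im by (auto simp: g_def row_comb_def sum.reindex fun_eq_iff)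
  qed
  have "row_span Y (\<lambda>i j. f (h i) (h j)) = g ` row_span X f"
  proof -
    have "Pow X = (\<lambda>A. h ` A) ` Pow Y" using im by (simp add: image_Pow_surj)
    then have "row_span X f = (\<lambda>A. row_comb X f (h ` A)) ` Pow Y"
      by (simp add: row_span_def image_image)
    then show ?thesis using gA by (simp add: row_span_def image_image)
  qed
  moreover have "inj_on g (row_span X f)"
  proof (rule inj_onI)
    fix u v assume uv: "u \<in> row_span X f" "v \<in> row_span X f" and eq: "g u = g v"
    show "u = v"
    proof
      fix x
      show "u x = v x"
      proof (cases "x \<in> X")
        case True
        then obtain y where "y \<in> Y" "x = h y" using im by auto
        then show ?thesis using fun_cong[OF eq, of y] by (simp add: g_def)
      qed (use uv row_span_outside in metis)
    qed
  qed
  ultimately show ?thesis by (simp add: card_image)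
qed

section \<open>Adding or removing two dimensions\<close>

lemma UNIV_bit: "(UNIV :: bit set) = {0, 1}"
  by (auto intro: bit.exhaust)

lemma card_UNIV_bit_bit: "finite (UNIV :: (bit \<times> bit) set)" "card (UNIV :: (bit \<times> bit) set) = 4"
proof -
  have *: "(UNIV :: (bit \<times> bit) set) = {0, 1} \<times> {0, 1}"
    by (simp flip: UNIV_bit)
  show "finite (UNIV :: (bit \<times> bit) set)" "card (UNIV :: (bit \<times> bit) set) = 4"
    unfolding * by (simp_all add: card_cartesian_product)
qed

text \<open>This parametrises the sum of a space \<open>W\<close> and the span of \<open>a\<close>
  and \<open>b\<close> by a set with 4 times as many elements as \<open>W\<close>. Sizes are then
  compared through the map: an upper bound always, equality when it is injective.\<close>

definition adjoin :: "('a \<Rightarrow> bit) \<Rightarrow> ('a \<Rightarrow> bit) \<Rightarrow> ('a \<Rightarrow> bit) \<times> bit \<times> bit \<Rightarrow> 'a \<Rightarrow> bit" where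
  "adjoin a b = (\<lambda>(w, \<alpha>, \<beta>) y. w y + \<alpha> * a y + \<beta> * b y)"

lemma add_closed_adjoin:
  assumes W: "add_closed W"
  shows "add_closed (adjoin a b ` (W \<times> UNIV))"
  unfolding add_closed_def
proof (intro conjI ballI)
  have "(\<lambda>_. 0) = adjoin a b (\<lambda>_. 0, 0, 0)" by (simp add: adjoin_def)
  then show "(\<lambda>_. 0) \<in> adjoin a b ` (W \<times> UNIV)" using W by (auto simp: add_closed_def)
next
  fix u v assume "u \<in> adjoin a b ` (W \<times> UNIV)" "v \<in> adjoin a b ` (W \<times> UNIV)"
  then obtain w \<alpha> \<beta> w' \<alpha>' \<beta>' where *: "w \<in> W" "w' \<in> W"
    "u = adjoin a b (w, \<alpha>, \<beta>)" "v = adjoin a b (w', \<alpha>', \<beta>')"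
    by auto
  then have "(\<lambda>y. u y + v y) = adjoin a b (\<lambda>y. w y + w' y, \<alpha> + \<alpha>', \<beta> + \<beta>')"
    by (simp add: adjoin_def algebra_simps fun_eq_iff)
  moreover have "(\<lambda>y. w y + w' y) \<in> W" using * add_closedD[OF W] by blast
  ultimately show "(\<lambda>y. u y + v y) \<in> adjoin a b ` (W \<times> UNIV)" by blast
qed

text \<open>Splitting off a hyperbolic plane: \<open>a\<close> and \<open>b\<close> are the row sums over \<open>P\<close> and \<open>Q\<close>, and
  summation over \<open>P\<close> and over \<open>Q\<close> are functionals dual to \<open>b\<close> and \<open>a\<close> that vanish on the
  remaining rows.\<close>

lemma card_row_span_split:
  fixes f :: "'a \<Rightarrow> 'a \<Rightarrow> bit"
  assumes X: "finite X" and P: "P \<subseteq> X" and Q: "Q \<subseteq> X"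
    and sym: "\<And>x y. x \<in> X \<Longrightarrow> y \<in> X \<Longrightarrow> f x y = f y x"
    and a: "\<And>y. y \<in> X \<Longrightarrow> a y = (\<Sum>x\<in>P. f x y)"
    and b: "\<And>y. y \<in> X \<Longrightarrow> b y = (\<Sum>x\<in>Q. f x y)"
    and PP: "(\<Sum>y\<in>P. a y) = 0" and QQ: "(\<Sum>y\<in>Q. b y) = 0" and PQ: "(\<Sum>y\<in>Q. a y) = 1"
  shows "card (row_span X f) = 4 * card (row_span X (\<lambda>x y. f x y + a x * b y + b x * a y))"
    (is "_ = 4 * card (row_span X ?g)")
proof -
  have fP: "(\<Sum>y\<in>P. f x y) = a x" if "x \<in> X" for x
    unfolding a[OF that] using sym P that by (intro sum.cong) auto
  have fQ: "(\<Sum>y\<in>Q. f x y) = b x" if "x \<in> X" for x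
    unfolding b[OF that] using sym Q that by (intro sum.cong) auto
  have "(\<Sum>y\<in>Q. a y) = (\<Sum>y\<in>Q. \<Sum>x\<in>P. f x y)"
    using a Q by (intro sum.cong) auto
  also have "\<dots> = (\<Sum>x\<in>P. \<Sum>y\<in>Q. f x y)" by (rule sum.swap)
  also have "\<dots> = (\<Sum>x\<in>P. b x)" using fQ P by (intro sum.cong) auto
  finally have QP: "(\<Sum>y\<in>P. b y) = 1" using PQ by simp
  \<comment> \<open>The zero-extended copies of \<open>a\<close> and \<open>b\<close>, which are
    elements of the row span.\<close>
  define a' b' where "a' = row_comb X f P" and "b' = row_comb X f Q"
  have ab': "y \<in> X \<Longrightarrow> a' y = a y" "y \<in> X \<Longrightarrow> b' y = b y" for y
    by (simp_all add: a'_def b'_def row_comb_def a b)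
  have sums: "(\<Sum>y\<in>P. a' y) = 0" "(\<Sum>y\<in>Q. a' y) = 1" "(\<Sum>y\<in>P. b' y) = 1" "(\<Sum>y\<in>Q. b' y) = 0"
    using PP QQ PQ QP ab' P Q by (metis (no_types, lifting) subsetD sum.cong)+
  let ?V = "row_span X f" and ?W = "row_span X ?g"
  have V: "add_closed ?V" and W: "add_closed ?W" using X add_closed_row_span by auto
  have a'V: "a' \<in> ?V" and b'V: "b' \<in> ?V" using P Q by (auto simp: a'_def b'_def row_comb_in)
  let ?T = "adjoin a' b'"
  have WV: "?W \<subseteq> ?V"
  proof (rule row_span_subsetI[OF V])
    fix x assume "x \<in> X"
    have "(\<lambda>y. if y \<in> X then ?g x y else 0) =
        (\<lambda>y. (if y \<in> X then f x y else 0) + a x * b' y + b x * a' y)"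
      using ab' by (auto simp: a'_def b'_def row_comb_def fun_eq_iff)
    also have "\<dots> \<in> ?V"
      using row_in_row_span[OF \<open>x \<in> X\<close>] a'V b'V by (intro add_closedD[OF V] add_closed_scale[OF V])
    finally show "(\<lambda>y. if y \<in> X then ?g x y else 0) \<in> ?V" .
  qed
  have T0: "?T ` (?W \<times> UNIV) \<subseteq> ?V"
    using WV a'V b'V by (auto simp: adjoin_def intro!: add_closedD[OF V] add_closed_scale[OF V])
  have T1: "?V \<subseteq> ?T ` (?W \<times> UNIV)"
  proof (rule row_span_subsetI[OF add_closed_adjoin[OF W]])
    fix x assume x: "x \<in> X"
    \<comment> \<open>Adding the two correction terms of \<open>?g\<close> a second time cancels
      them, which explains the coefficients \<open>b x\<close> and \<open>a x\<close>.\<close>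
    have "(\<lambda>y. if y \<in> X then f x y else 0) = ?T (\<lambda>y. if y \<in> X then ?g x y else 0, b x, a x)"
    proof
      fix y
      have "p = p + u + v + v + u" for p u v :: bit by (cases p; cases u; cases v) simp_all
      then show "(if y \<in> X then f x y else 0) = ?T (\<lambda>y. if y \<in> X then ?g x y else 0, b x, a x) y"
        using ab' by (auto simp: adjoin_def a'_def b'_def row_comb_def)
    qed
    then show "(\<lambda>y. if y \<in> X then f x y else 0) \<in> ?T ` (?W \<times> UNIV)"
      using row_in_row_span[OF x, of ?g] by auto
  qed
  \<comment> \<open>Both functionals kill the generating rows of \<open>?g\<close>: over
    \<open>P\<close> the sum is \<open>a x + a x * 1 + b x * 0\<close>, over \<open>Q\<close> it is
    \<open>b x + a x * 0 + b x * 1\<close>.\<close>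
  have W0: "(\<Sum>y\<in>P. w y) = 0 \<and> (\<Sum>y\<in>Q. w y) = 0" if "w \<in> ?W" for w
  proof -
    have "?W \<subseteq> {w. (\<Sum>y\<in>P. w y) = 0 \<and> (\<Sum>y\<in>Q. w y) = 0}"
    proof (rule row_span_subsetI)
      show "add_closed {w. (\<Sum>y\<in>P. w y) = 0 \<and> (\<Sum>y\<in>Q. w y) = 0}"
        by (auto simp: add_closed_def sum.distrib)
      fix x assume x: "x \<in> X"
      have "(\<Sum>y\<in>A. if y \<in> X then h y else 0) = sum h A" if "A \<subseteq> X" for A and h :: "'a \<Rightarrow> bit"
        using that by (intro sum.cong) auto
      then show "(\<lambda>y. if y \<in> X then ?g x y else 0) \<in> {w. (\<Sum>y\<in>P. w y) = 0 \<and> (\<Sum>y\<in>Q. w y) = 0}"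
        using fP[OF x] fQ[OF x] PP QQ PQ QP P Q
        by (simp add: sum.distrib flip: sum_distrib_left)
    qed
    then show ?thesis using that by blast
  qed
  have "inj_on ?T (?W \<times> UNIV)"
  proof (rule inj_onI)
    fix u v assume "u \<in> ?W \<times> UNIV" "v \<in> ?W \<times> UNIV" and uv: "?T u = ?T v"
    then obtain w \<alpha> \<beta> w' \<alpha>' \<beta>' where w: "w \<in> ?W" "w' \<in> ?W" and
      u: "u = (w, \<alpha>, \<beta>)" "v = (w', \<alpha>', \<beta>')"
      by (cases u, cases v) auto
    have eq: "?T (w, \<alpha>, \<beta>) = ?T (w', \<alpha>', \<beta>')" using uv u by simp
    \<comment> \<open>Summing over \<open>P\<close> reads off the coefficient of \<open>b'\<close>,
      summing over \<open>Q\<close> that of \<open>a'\<close>; this gives injectivity.\<close>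
    have *: "(\<Sum>y\<in>P. ?T (v, \<gamma>, \<delta>) y) = \<delta>" "(\<Sum>y\<in>Q. ?T (v, \<gamma>, \<delta>) y) = \<gamma>" if "v \<in> ?W" for v \<gamma> \<delta>
      using W0[OF that] sums by (simp_all add: adjoin_def sum.distrib flip: sum_distrib_left)
    have "\<alpha> = \<alpha>'" using *(2)[OF w(1), of \<alpha> \<beta>] *(2)[OF w(2), of \<alpha>' \<beta>'] eq by simp
    moreover have "\<beta> = \<beta>'" using *(1)[OF w(1), of \<alpha> \<beta>] *(1)[OF w(2), of \<alpha>' \<beta>'] eq by simp
    ultimately have "w = w'" using eq by (simp add: adjoin_def fun_eq_iff)
    with \<open>\<alpha> = \<alpha>'\<close> \<open>\<beta> = \<beta>'\<close> show "u = v" by (simp add: u)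
  qed
  then have "card (?T ` (?W \<times> UNIV)) = card (?W \<times> (UNIV :: (bit \<times> bit) set))"
    by (rule card_image)
  moreover have "?T ` (?W \<times> UNIV) = ?V" using T0 T1 by blast
  ultimately show ?thesis by (simp add: card_cartesian_product card_UNIV_bit_bit)
qed

text \<open>Every new row is an old row plus a combination of \<open>s\<close> and \<open>t\<close>,
  so at most two dimensions are added.\<close>

lemma card_row_span_update_le:
  fixes f :: "'a \<Rightarrow> 'a \<Rightarrow> bit"
  assumes X: "finite X"
  shows "card (row_span X (\<lambda>x y. f x y + s x * t y + t x * s y)) \<le> 4 * card (row_span X f)"
    (is "card (row_span X ?g) \<le> _")
proof -
  let ?V = "row_span X f"
  have V: "add_closed ?V" using X add_closed_row_span by auto
  define s' t' where "s' = (\<lambda>y. if y \<in> X then s y else 0)" and "t' = (\<lambda>y. if y \<in> X then t y else 0)"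
  let ?T = "adjoin t' s'"
  have "row_span X ?g \<subseteq> ?T ` (?V \<times> UNIV)"
  proof (rule row_span_subsetI[OF add_closed_adjoin[OF V]])
    fix x assume x: "x \<in> X"
    have "(\<lambda>y. if y \<in> X then ?g x y else 0) = ?T (\<lambda>y. if y \<in> X then f x y else 0, s x, t x)"
      by (auto simp: adjoin_def s'_def t'_def)
    then show "(\<lambda>y. if y \<in> X then ?g x y else 0) \<in> ?T ` (?V \<times> UNIV)"
      using row_in_row_span[OF x, of f] by auto
  qed
  then have "card (row_span X ?g) \<le> card (?T ` (?V \<times> UNIV))"
    by (intro card_mono finite_imageI finite_cartesian_product finite_row_span X card_UNIV_bit_bit)
  also have "\<dots> \<le> card (?V \<times> (UNIV :: (bit \<times> bit) set))"
    by (intro card_image_le finite_cartesian_product finite_row_span X card_UNIV_bit_bit)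
  also have "\<dots> = 4 * card ?V" by (simp add: card_cartesian_product card_UNIV_bit_bit)
  finally show ?thesis .
qed

section \<open>Alternating forms and normalisation at a vertex\<close>

definition alternating :: "'a set \<Rightarrow> ('a \<Rightarrow> 'a \<Rightarrow> bit) \<Rightarrow> bool" where
  "alternating X f \<longleftrightarrow> (\<forall>x\<in>X. \<forall>y\<in>X. f x y = f y x) \<and> (\<forall>x\<in>X. f x x = 0)"

lemma card_row_span_pos: "finite X \<Longrightarrow> card (row_span X f) > 0"
  using add_closed_row_span[of X f] finite_row_span[of X f]
  by (auto simp: card_gt_0_iff add_closed_def)

text \<open>One pivot of symplectic Gaussian elimination: \<open>P\<close> and \<open>Q\<close> are
  singletons, and the zero diagonal makes both sums \<open>PP\<close> and \<open>QQ\<close>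
  vanish.\<close>

lemma card_row_span_split_pair:
  assumes X: "finite X" and f: "alternating X f" and pq: "p \<in> X" "q \<in> X" "f p q = 1"
  shows "card (row_span X f) =
    4 * card (row_span X (\<lambda>x y. f x y + f p x * f q y + f q x * f p y))"
  using pq f by (intro card_row_span_split[OF X, where P = "{p}" and Q = "{q}"])
    (auto simp: alternating_def)

lemma alternating_split:
  assumes "alternating X f" "p \<in> X" "q \<in> X"
  shows "alternating X (\<lambda>x y. f x y + f p x * f q y + f q x * f p y)"
  using assms by (auto simp: alternating_def algebra_simps)

lemma card_row_span_zero:
  assumes X: "finite X" and f: "\<And>x y. x \<in> X \<Longrightarrow> y \<in> X \<Longrightarrow> f x y = 0"
  shows "card (row_span X f) = 1"
proof -
  have "row_span X f \<subseteq> {\<lambda>_. 0}"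
    using f by (intro row_span_subsetI) (auto simp: add_closed_def)
  then have "row_span X f = {\<lambda>_. 0}"
    using add_closed_row_span[OF X, of f] by (auto simp: add_closed_def)
  then show ?thesis by simp
qed

text \<open>This is the evenness of the rank: as long as some entry is 1, a hyperbolic plane splits
  off and the span shrinks by a factor of 4.\<close>

lemma card_row_span_alternating:
  assumes X: "finite X" and "alternating X f"
  shows "\<exists>k. card (row_span X f) = 4 ^ k"
  using assms(2)
proof (induction "card (row_span X f)" arbitrary: f rule: less_induct)
  case less
  show ?case
  proof (cases "\<exists>p\<in>X. \<exists>q\<in>X. f p q = 1")
    case True
    then obtain p q where pq: "p \<in> X" "q \<in> X" "f p q = 1" by blast
    let ?g = "\<lambda>x y. f x y + f p x * f q y + f q x * f p y"
    have eq: "card (row_span X f) = 4 * card (row_span X ?g)"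
      using card_row_span_split_pair[OF X less.prems pq] .
    moreover have "card (row_span X ?g) > 0" using X card_row_span_pos by blast
    ultimately obtain k where "card (row_span X ?g) = 4 ^ k"
      using less.hyps[of ?g] alternating_split[OF less.prems pq(1,2)] by auto
    with eq show ?thesis by (metis power_Suc)
  next
    case False
    then have "card (row_span X f) = 1" using X by (intro card_row_span_zero) auto
    then show ?thesis by (intro exI[of _ 0]) simp
  qed
qed

text \<open>In graph terms this is Seidel switching with respect to the neighbourhood of
  \<open>p\<close>; for an alternating form it isolates \<open>p\<close>.\<close>

definition normalise :: "'a \<Rightarrow> ('a \<Rightarrow> 'a \<Rightarrow> bit) \<Rightarrow> 'a \<Rightarrow> 'a \<Rightarrow> bit" where
  "normalise p f = (\<lambda>x y. f x y + f p x + f p y)"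

text \<open>Split with \<open>P = {p}\<close> and \<open>Q = z\<close>. The row sum over
  \<open>z\<close> is the all-one vector, so the correction terms become \<open>f p x\<close> and
  \<open>f p y\<close>; evenness of \<open>card z\<close> makes the all-one vector sum to 0 over
  \<open>z\<close>.\<close>

lemma card_row_span_normalise:
  assumes X: "finite X" and f: "alternating X f" and p: "p \<in> X"
    and z: "z \<subseteq> X" "even (card z)" "\<And>y. y \<in> X \<Longrightarrow> (\<Sum>u\<in>z. f u y) = 1"
  shows "card (row_span X f) = 4 * card (row_span X (normalise p f))"
proof -
  have "(\<Sum>y\<in>z. f p y) = (\<Sum>y\<in>z. f y p)"
    using f p z(1) by (intro sum.cong) (auto simp: alternating_def)
  then have "card (row_span X f) = 4 * card (row_span X (\<lambda>x y. f x y + f p x * 1 + 1 * f p y))"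
    using f p z by (intro card_row_span_split[OF X, where P = "{p}" and Q = z])
      (auto simp: alternating_def elim!: evenE)
  then show ?thesis by (simp add: normalise_def)
qed

lemma alternating_normalise:
  assumes "alternating X f" "p \<in> X"
  shows "alternating X (normalise p f)"
  using assms by (auto simp: alternating_def normalise_def algebra_simps)

lemma normalise_base:
  assumes "alternating X f" "p \<in> X" "x \<in> X"
  shows "normalise p f p x = 0" "normalise p f x p = 0"
  using assms by (auto simp: alternating_def normalise_def)

section \<open>Direct sums of forms\<close>

definition form_sum :: "('a \<Rightarrow> 'a \<Rightarrow> bit) \<Rightarrow> ('b \<Rightarrow> 'b \<Rightarrow> bit) \<Rightarrow> 'a \<times> 'b \<Rightarrow> 'a \<times> 'b \<Rightarrow> bit" where
  "form_sum f g = (\<lambda>p q. f (fst p) (fst q) + g (snd p) (snd q))"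

text \<open>Vectors of the large span are sums of a function \<open>u\<close> of the first and
  \<open>v\<close> of the second coordinate. As \<open>u\<close> vanishes at \<open>p\<close> and
  \<open>v\<close> at \<open>q\<close>, both are determined by the sum. Rows indexed by
  \<open>X \<times> {q}\<close> produce the \<open>u\<close> alone, rows indexed by
  \<open>{p} \<times> Y\<close> the \<open>v\<close> alone.\<close>

lemma card_row_span_form_sum:
  assumes X: "finite X" and Y: "finite Y" and p: "p \<in> X" and q: "q \<in> Y"
    and f0: "\<And>x. x \<in> X \<Longrightarrow> f p x = 0 \<and> f x p = 0" and g0: "\<And>y. y \<in> Y \<Longrightarrow> g q y = 0 \<and> g y q = 0"
  shows "card (row_span (X \<times> Y) (form_sum f g)) = card (row_span X f) * card (row_span Y g)"
proof -
  let ?V = "row_span (X \<times> Y) (form_sum f g)"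
  have V: "add_closed ?V" by (simp add: X Y add_closed_row_span)
  define T where "T = (\<lambda>(w :: ('a \<Rightarrow> bit) \<times> ('b \<Rightarrow> bit)) z.
    if z \<in> X \<times> Y then fst w (fst z) + snd w (snd z) else 0)"
  have T_add: "(\<lambda>z. T (u, v) z + T (u', v') z) = T (\<lambda>x. u x + u' x, \<lambda>y. v y + v' y)" for u v u' v'
    by (simp add: T_def fun_eq_iff algebra_simps)
  have closed: "add_closed (T ` (row_span X f \<times> row_span Y g))"
    using add_closed_row_span[OF X, of f] add_closed_row_span[OF Y, of g]
    unfolding add_closed_def[of "T ` _"]
  proof (intro conjI ballI, goal_cases)
    case 1
    have "(\<lambda>_. 0) = T (\<lambda>_. 0, \<lambda>_. 0)" by (auto simp: T_def)
    then show ?case using 1 by (auto simp: add_closed_def)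
  next
    case (2 u v)
    then obtain w1 w2 w1' w2' where "w1 \<in> row_span X f" "w2 \<in> row_span Y g"
      "w1' \<in> row_span X f" "w2' \<in> row_span Y g" "u = T (w1, w2)" "v = T (w1', w2')" by auto
    with 2 show ?case by (auto simp: T_add intro!: imageI add_closedD)
  qed
  have "?V \<subseteq> T ` (row_span X f \<times> row_span Y g)"
  proof (rule row_span_subsetI[OF closed])
    fix z assume "z \<in> X \<times> Y"
    then obtain x y where z: "z = (x, y)" "x \<in> X" "y \<in> Y" by auto
    have "(\<lambda>z'. if z' \<in> X \<times> Y then form_sum f g z z' else 0) =
      T (\<lambda>x'. if x' \<in> X then f x x' else 0, \<lambda>y'. if y' \<in> Y then g y y' else 0)"
      by (auto simp: T_def form_sum_def z)
    moreover have "(\<lambda>x'. if x' \<in> X then f x x' else 0, \<lambda>y'. if y' \<in> Y then g y y' else 0)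
        \<in> row_span X f \<times> row_span Y g"
      using row_in_row_span[OF z(2), of f] row_in_row_span[OF z(3), of g] by simp
    ultimately show "(\<lambda>z'. if z' \<in> X \<times> Y then form_sum f g z z' else 0)
        \<in> T ` (row_span X f \<times> row_span Y g)"
      by (simp only: imageI)
  qed
  moreover have "T ` (row_span X f \<times> row_span Y g) \<subseteq> ?V"
  proof clarify
    fix u v assume "u \<in> row_span X f" "v \<in> row_span Y g"
    then obtain A B where A: "A \<subseteq> X" "u = row_comb X f A" and B: "B \<subseteq> Y" "v = row_comb Y g B"
      by (auto simp: row_span_def)
    have "T (u, \<lambda>_. 0) = row_comb (X \<times> Y) (form_sum f g) (A \<times> {q})"
      using g0 by (simp add: T_def A(2) row_comb_def form_sum_def fun_eq_iff
        sum.cartesian_product' del: sum.distrib)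
    moreover have "T (\<lambda>_. 0, v) = row_comb (X \<times> Y) (form_sum f g) ({p} \<times> B)"
      using f0 by (simp add: T_def B(2) row_comb_def form_sum_def fun_eq_iff
        sum.cartesian_product' del: sum.distrib)
    ultimately have "T (u, \<lambda>_. 0) \<in> ?V" "T (\<lambda>_. 0, v) \<in> ?V"
      using A(1) B(1) p q by (auto intro!: row_comb_in)
    then show "T (u, v) \<in> ?V"
      using add_closedD[OF V, of "T (u, \<lambda>_. 0)" "T (\<lambda>_. 0, v)"] by (simp add: T_add)
  qed
  moreover have "inj_on T (row_span X f \<times> row_span Y g)"
  proof (rule inj_onI, clarify)
    fix u v u' v' assume uv: "u \<in> row_span X f" "v \<in> row_span Y g" "u' \<in> row_span X f" "v' \<in> row_span Y g"
      and eq: "T (u, v) = T (u', v')"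
    have 0: "w p = 0" if "w \<in> row_span X f" for w
      using that f0 p by (auto simp: row_span_def row_comb_def subset_iff intro!: sum.neutral)
    have 1: "w q = 0" if "w \<in> row_span Y g" for w
      using that g0 q by (auto simp: row_span_def row_comb_def subset_iff intro!: sum.neutral)
    have "u x = u' x" for x
      using fun_cong[OF eq, of "(x, q)"] row_span_outside[OF uv(1), of x]
        row_span_outside[OF uv(3), of x] 1[OF uv(2)] 1[OF uv(4)] q
      by (cases "x \<in> X") (auto simp: T_def)
    moreover have "v y = v' y" for y
      using fun_cong[OF eq, of "(p, y)"] row_span_outside[OF uv(2), of y]
        row_span_outside[OF uv(4), of y] 0[OF uv(1)] 0[OF uv(3)] p
      by (cases "y \<in> Y") (auto simp: T_def)
    ultimately show "u = u' \<and> v = v'" by auto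
  qed
  ultimately have "card ?V = card (row_span X f \<times> row_span Y g)"
    by (metis card_image subset_antisym)
  then show ?thesis by (simp add: card_cartesian_product)
qed

subsection \<open>Regular graphical Hadamard matrices\<close>

definition chi :: "bit \<Rightarrow> real" where
  "chi b = (if b = 0 then 1 else - 1)"

lemma chi_simps [simp]: "chi 0 = 1" "chi 1 = - 1" "chi a * chi a = 1"
  by (auto simp: chi_def)

lemma chi_add: "chi (a + b) = chi a * chi b"
  by (cases a; cases b) auto

text \<open>The matrix meant is the one with entries \<open>chi (f x y)\<close>. Its entries are
  signs, so the product of a row with itself is \<open>card X\<close> automatically and
  orthogonality is demanded for distinct rows only.\<close>

definition regular_hadamard :: "'a set \<Rightarrow> ('a \<Rightarrow> 'a \<Rightarrow> bit) \<Rightarrow> real \<Rightarrow> bool" where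
  "regular_hadamard X f c \<longleftrightarrow> finite X \<and> alternating X f \<and>
     (\<forall>x\<in>X. \<forall>y\<in>X. x \<noteq> y \<longrightarrow> (\<Sum>z\<in>X. chi (f x z) * chi (f y z)) = 0) \<and>
     (\<forall>x\<in>X. (\<Sum>y\<in>X. chi (f x y)) = c)"

text \<open>The last condition says that the all-one vector is a sum of rows. It makes the rank exceed
  the rank of the normalised form by exactly two, and the latter is additive under direct sums.\<close>

definition hadamard_rank :: "'a set \<Rightarrow> ('a \<Rightarrow> 'a \<Rightarrow> bit) \<Rightarrow> real \<Rightarrow> nat \<Rightarrow> bool" where
  "hadamard_rank X f c k \<longleftrightarrow> regular_hadamard X f c \<and> card (row_span X f) = 4 ^ Suc k \<and>
     (\<exists>z\<subseteq>X. even (card z) \<and> (\<forall>y\<in>X. (\<Sum>u\<in>z. f u y) = 1))"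

text \<open>\<open>chi\<close> turns the direct sum into a Kronecker product, so every sum over
  \<open>X \<times> Y\<close> factors.\<close>

lemma regular_hadamard_form_sum:
  assumes f: "regular_hadamard X f c" and g: "regular_hadamard Y g d"
  shows "regular_hadamard (X \<times> Y) (form_sum f g) (c * d)"
  unfolding regular_hadamard_def
proof (intro conjI ballI impI)
  show "finite (X \<times> Y)" using f g by (auto simp: regular_hadamard_def)
  show "alternating (X \<times> Y) (form_sum f g)"
    using f g by (auto simp: regular_hadamard_def alternating_def form_sum_def)
next
  fix p assume "p \<in> X \<times> Y"
  then obtain x y where p: "p = (x, y)" "x \<in> X" "y \<in> Y" by auto
  have "(\<Sum>q\<in>X \<times> Y. chi (form_sum f g p q)) = (\<Sum>z\<in>X. chi (f x z)) * (\<Sum>w\<in>Y. chi (g y w))"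
    by (simp add: p form_sum_def chi_add sum_product sum.cartesian_product' )
  then show "(\<Sum>q\<in>X \<times> Y. chi (form_sum f g p q)) = c * d"
    using f g p by (simp add: regular_hadamard_def)
next
  fix p p' assume "p \<in> X \<times> Y" "p' \<in> X \<times> Y" "p \<noteq> p'"
  then obtain x y x' y' where p: "p = (x, y)" "x \<in> X" "y \<in> Y" "p' = (x', y')" "x' \<in> X" "y' \<in> Y"
    "x \<noteq> x' \<or> y \<noteq> y'" by auto
  have "(\<Sum>q\<in>X \<times> Y. chi (form_sum f g p q) * chi (form_sum f g p' q)) =
      (\<Sum>z\<in>X. chi (f x z) * chi (f x' z)) * (\<Sum>w\<in>Y. chi (g y w) * chi (g y' w))"
    by (simp add: p form_sum_def chi_add sum_product sum.cartesian_product'  mult_ac)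
  then show "(\<Sum>q\<in>X \<times> Y. chi (form_sum f g p q) * chi (form_sum f g p' q)) = 0"
    using f g p by (auto simp: regular_hadamard_def)
qed

lemma hadamard_rank_cong:
  assumes "hadamard_rank X f c k" "\<And>x y. x \<in> X \<Longrightarrow> y \<in> X \<Longrightarrow> f x y = g x y"
  shows "hadamard_rank X g c k"
proof -
  have "row_span X f = row_span X g" using assms(2) by (rule row_span_cong)
  moreover have "(\<Sum>u\<in>z. f u y) = (\<Sum>u\<in>z. g u y)" if "z \<subseteq> X" "y \<in> X" for z y
    using that assms(2) by (intro sum.cong) auto
  moreover have "regular_hadamard X g c"
    using assms by (simp add: hadamard_rank_def regular_hadamard_def alternating_def)
  ultimately show ?thesis using assms(1) unfolding hadamard_rank_def by metis
qed

lemma hadamard_rank_nonempty: "hadamard_rank X f c k \<Longrightarrow> X \<noteq> {}"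
  by (auto simp: hadamard_rank_def row_span_def)

lemma hadamard_rank_normalise:
  assumes "hadamard_rank X f c k" "p \<in> X"
  shows "card (row_span X (normalise p f)) = 4 ^ k"
proof -
  obtain z where "z \<subseteq> X" "even (card z)" "\<And>y. y \<in> X \<Longrightarrow> (\<Sum>u\<in>z. f u y) = 1"
    using assms by (auto simp: hadamard_rank_def)
  then have "card (row_span X f) = 4 * card (row_span X (normalise p f))"
    using assms by (intro card_row_span_normalise) (auto simp: hadamard_rank_def regular_hadamard_def)
  then show ?thesis using assms by (simp add: hadamard_rank_def)
qed

text \<open>The rank is computed through the normalised forms: normalising commutes with direct
  sums, and the normalised summands have zero rows at their base points, so their span sizes
  multiply.\<close>

lemma hadamard_rank_form_sum:
  assumes f: "hadamard_rank X f c k" and g: "hadamard_rank Y g d l"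
  shows "hadamard_rank (X \<times> Y) (form_sum f g) (c * d) (k + l)"
proof -
  obtain p q where p: "p \<in> X" and q: "q \<in> Y"
    using hadamard_rank_nonempty[OF f] hadamard_rank_nonempty[OF g] by auto
  have X: "finite X" "alternating X f" and Y: "finite Y" "alternating Y g"
    using f g by (auto simp: hadamard_rank_def regular_hadamard_def)
  obtain z where z: "z \<subseteq> X" "even (card z)" "\<And>y. y \<in> X \<Longrightarrow> (\<Sum>u\<in>z. f u y) = 1"
    using f by (auto simp: hadamard_rank_def)
  have R: "regular_hadamard (X \<times> Y) (form_sum f g) (c * d)"
    using f g by (intro regular_hadamard_form_sum) (auto simp: hadamard_rank_def)
  \<comment> \<open>The row of \<open>g\<close> at \<open>q\<close> is added \<open>card z\<close>
    times, an even number, so only the all-one vector from \<open>f\<close> remains.\<close>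
  have Z: "z \<times> {q} \<subseteq> X \<times> Y" "even (card (z \<times> {q}))"
    "\<And>y. y \<in> X \<times> Y \<Longrightarrow> (\<Sum>u\<in>z \<times> {q}. form_sum f g u y) = 1"
    using z q by (auto simp: form_sum_def card_cartesian_product sum.cartesian_product'
        sum.distrib elim!: evenE)
  have "normalise (p, q) (form_sum f g) = form_sum (normalise p f) (normalise q g)"
    by (auto simp: normalise_def form_sum_def fun_eq_iff algebra_simps)
  then have "card (row_span (X \<times> Y) (normalise (p, q) (form_sum f g))) =
      card (row_span X (normalise p f)) * card (row_span Y (normalise q g))"
    using X Y p q normalise_base[OF X(2) p] normalise_base[OF Y(2) q]
    by (simp add: card_row_span_form_sum)
  also have "\<dots> = 4 ^ (k + l)"
    using hadamard_rank_normalise[OF f p] hadamard_rank_normalise[OF g q] by (simp add: power_add)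
  finally have "card (row_span (X \<times> Y) (form_sum f g)) = 4 ^ Suc (k + l)"
    using card_row_span_normalise[OF _ _ _ Z, where p = "(p, q)"] R p q
    by (auto simp: regular_hadamard_def)
  then show ?thesis using R Z unfolding hadamard_rank_def by blast
qed

lemma hadamard_rank_reindex:
  assumes f: "hadamard_rank X f c k" and h: "bij_betw h Y X"
  shows "hadamard_rank Y (\<lambda>i j. f (h i) (h j)) c k"
proof -
  have inj: "inj_on h Y" and im: "h ` Y = X" using h by (auto simp: bij_betw_def)
  have hY: "h i \<in> X" if "i \<in> Y" for i using im that by blast
  have S: "(\<Sum>j\<in>Y. G (h j)) = (\<Sum>x\<in>X. G x)" for G :: "'a \<Rightarrow> real"
    using sum.reindex_bij_betw[OF h] .
  have "regular_hadamard Y (\<lambda>i j. f (h i) (h j)) c"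
    unfolding regular_hadamard_def
  proof (intro conjI ballI impI)
    show "finite Y" using f h by (simp add: hadamard_rank_def regular_hadamard_def bij_betw_finite)
    show "alternating Y (\<lambda>i j. f (h i) (h j))"
      using f hY by (auto simp: hadamard_rank_def regular_hadamard_def alternating_def)
    show "(\<Sum>j\<in>Y. chi (f (h i) (h j))) = c" if "i \<in> Y" for i
      using f hY[OF that] S[of "\<lambda>x. chi (f (h i) x)"]
      by (simp add: hadamard_rank_def regular_hadamard_def)
    show "(\<Sum>z\<in>Y. chi (f (h i) (h z)) * chi (f (h j) (h z))) = 0"
      if "i \<in> Y" "j \<in> Y" "i \<noteq> j" for i j
      using f hY that inj S[of "\<lambda>x. chi (f (h i) x) * chi (f (h j) x)"]
      by (simp add: hadamard_rank_def regular_hadamard_def inj_on_eq_iff)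
  qed
  moreover obtain z where z: "z \<subseteq> X" "even (card z)" "\<And>y. y \<in> X \<Longrightarrow> (\<Sum>u\<in>z. f u y) = 1"
    using f by (auto simp: hadamard_rank_def)
  have "\<exists>z\<subseteq>Y. even (card z) \<and> (\<forall>y\<in>Y. (\<Sum>u\<in>z. f (h u) (h y)) = 1)"
  proof (intro exI conjI ballI)
    define w where "w = {i \<in> Y. h i \<in> z}"
    have b: "bij_betw h w z" using inj im z(1) by (auto simp: w_def bij_betw_def inj_on_def)
    show "w \<subseteq> Y" by (auto simp: w_def)
    show "even (card w)" using z(2) bij_betw_same_card[OF b] by simp
    show "(\<Sum>u\<in>w. f (h u) (h y)) = 1" if "y \<in> Y" for y
      using sum.reindex_bij_betw[OF b, of "\<lambda>u. f u (h y)"] z(3)[OF hY[OF that]] by simp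
  qed
  ultimately show ?thesis using f row_span_reindex[OF h, of f] by (simp add: hadamard_rank_def)
qed

subsection \<open>Godsil--McKay switching\<close>

text \<open>With \<open>Q\<close> the identity outside \<open>S\<close> and \<open>J/2 - I\<close> on \<open>S\<close>, the matrix \<open>H'\<close> is \<open>QHQ\<close>,
  and \<open>Q\<close> is an orthogonal matrix that fixes the all-one vector.\<close>

lemma
  fixes H :: "'a \<Rightarrow> 'a \<Rightarrow> real"
  assumes X: "finite X" and S: "S \<subseteq> X" "card S = 4"
    and sym: "\<And>x y. x \<in> X \<Longrightarrow> y \<in> X \<Longrightarrow> H x y = H y x"
    and orth: "\<And>x y. x \<in> X \<Longrightarrow> y \<in> X \<Longrightarrow> (\<Sum>z\<in>X. H x z * H y z) = (if x = y then n else 0)"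
    and row: "\<And>x. x \<in> X \<Longrightarrow> (\<Sum>y\<in>X. H x y) = c"
    and d: "\<And>x. x \<in> S \<Longrightarrow> (\<Sum>u\<in>S. H x u) = d"
    and out: "\<And>x y. x \<in> X - S \<Longrightarrow> y \<in> S \<Longrightarrow> H' x y = (\<Sum>u\<in>S. H x u) / 2 - H x y"
    and out': "\<And>x y. x \<in> S \<Longrightarrow> y \<in> X - S \<Longrightarrow> H' x y = H' y x"
    and same: "\<And>x y. x \<in> X - S \<Longrightarrow> y \<in> X - S \<Longrightarrow> H' x y = H x y"
      "\<And>x y. x \<in> S \<Longrightarrow> y \<in> S \<Longrightarrow> H' x y = H x y"
  shows switching_orthogonal: "\<And>x y. x \<in> X \<Longrightarrow> y \<in> X \<Longrightarrow> x \<noteq> y \<Longrightarrow> (\<Sum>z\<in>X. H' x z * H' y z) = 0"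
    and switching_row_sum: "\<And>x. x \<in> X \<Longrightarrow> (\<Sum>y\<in>X. H' x y) = c"
proof -
  define \<sigma> where "\<sigma> x = (\<Sum>u\<in>S. H x u)" for x
  have split: "(\<Sum>z\<in>X. G z) = (\<Sum>z\<in>X - S. G z) + (\<Sum>z\<in>S. G z)" for G :: "'a \<Rightarrow> real"
    using sum.subset_diff[OF S(1) X] .
  have SX: "x \<in> X" if "x \<in> S" for x using S that by blast
  have H'o: "H' x y = \<sigma> x / 2 - H x y" if "x \<in> X - S" "y \<in> S" for x y
    using out that by (simp add: \<sigma>_def)
  have H'i: "H' x y = \<sigma> y / 2 - H x y" if "x \<in> S" "y \<in> X - S" for x y
    \<comment> \<open>By symmetry of \<open>H\<close> the block from \<open>S\<close> to its
      complement is the transpose of the one just treated.\<close>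
    using out'[OF that] H'o[OF that(2,1)] sym that SX by simp
  have \<sigma>_sym: "\<sigma> y = (\<Sum>u\<in>S. H u y)" if "y \<in> X" for y
    unfolding \<sigma>_def using that SX sym by (intro sum.cong) auto
  have corr: "(\<Sum>z\<in>X - S. H x z * H y z) = (if x = y then n else 0) - (\<Sum>z\<in>S. H x z * H y z)"
    if "x \<in> X" "y \<in> X" for x y
    using orth[OF that] split[of "\<lambda>z. H x z * H y z"] by simp
  \<comment> \<open>\<open>\<sigma>\<close> is the sum of the four rows in \<open>S\<close>. Over
    all of \<open>X\<close> its product with row \<open>y\<close> is \<open>n\<close> or 0 by
    orthogonality; the part inside \<open>S\<close>, where \<open>\<sigma>\<close> is constantly
    \<open>d\<close>, is subtracted.\<close>
  have \<sigma>_corr: "(\<Sum>z\<in>X - S. \<sigma> z * H y z) = (if y \<in> S then n else 0) - d * \<sigma> y" if "y \<in> X" for y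
  proof -
    have "(\<Sum>z\<in>X - S. \<sigma> z * H y z) = (\<Sum>z\<in>X - S. \<Sum>u\<in>S. H u z * H y z)"
      by (intro sum.cong) (auto simp: \<sigma>_sym sum_distrib_right)
    also have "\<dots> = (\<Sum>u\<in>S. \<Sum>z\<in>X - S. H u z * H y z)" by (rule sum.swap)
    also have "\<dots> = (\<Sum>u\<in>S. (if u = y then n else 0) - (\<Sum>z\<in>S. H u z * H y z))"
      using that SX corr by (intro sum.cong) auto
    also have "\<dots> = (\<Sum>u\<in>S. if u = y then n else 0) - (\<Sum>z\<in>S. \<Sum>u\<in>S. H u z * H y z)"
      using sum.swap[of "\<lambda>u z. H u z * H y z" S S] by (simp add: sum_subtractf)
    also have "(\<Sum>u\<in>S. if u = y then n else 0) = (if y \<in> S then n else 0)"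
      using finite_subset[OF S(1) X] by simp
    also have "(\<Sum>z\<in>S. \<Sum>u\<in>S. H u z * H y z) = (\<Sum>z\<in>S. d * H y z)"
      using d SX \<sigma>_sym by (intro sum.cong refl) (simp add: \<sigma>_def flip: sum_distrib_right)
    finally show ?thesis by (simp add: \<sigma>_def sum_distrib_left)
  qed
  show "(\<Sum>y\<in>X. H' x y) = c" if x: "x \<in> X" for x
  proof (cases "x \<in> S")
    case True
    have "(\<Sum>y\<in>X - S. \<sigma> y) = (\<Sum>y\<in>X - S. \<Sum>u\<in>S. H u y)"
      by (intro sum.cong) (auto simp: \<sigma>_sym)
    also have "\<dots> = (\<Sum>u\<in>S. \<Sum>y\<in>X - S. H u y)" by (rule sum.swap)
    also have "\<dots> = (\<Sum>u\<in>S. c - d)"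
    proof (intro sum.cong refl)
      fix u assume "u \<in> S"
      then show "(\<Sum>y\<in>X - S. H u y) = c - d" using row[of u] SX d[of u] split[of "H u"] by simp
    qed
    also have "\<dots> = 4 * (c - d)" using S by simp
    finally have \<sigma>: "(\<Sum>y\<in>X - S. \<sigma> y) = 4 * (c - d)" .
    have "(\<Sum>y\<in>X. H' x y) = (\<Sum>y\<in>X - S. \<sigma> y / 2 - H x y) + (\<Sum>y\<in>S. H x y)"
      unfolding split using True H'i same by simp
    also have "\<dots> = (\<Sum>y\<in>X - S. \<sigma> y) / 2 - (\<Sum>y\<in>X - S. H x y) + (\<Sum>y\<in>S. H x y)"
      by (simp add: sum_subtractf sum_divide_distrib)
    also have "\<dots> = 2 * (c - d) - (c - d) + d"
      using \<sigma> row[OF x] d[OF True] split[of "H x"] by (simp add: field_simps)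
    finally show ?thesis by simp
  next
    case False
    have "(\<Sum>y\<in>X. H' x y) = (\<Sum>y\<in>X - S. H x y) + (\<Sum>y\<in>S. \<sigma> x / 2 - H x y)"
      unfolding split using x False H'o same by simp
    also have "\<dots> = (\<Sum>y\<in>X - S. H x y) + (\<Sum>y\<in>S. H x y)"
      using S by (simp add: sum_subtractf \<sigma>_def)
    finally show ?thesis using row[OF x] split[of "H x"] by simp
  qed
  show "(\<Sum>z\<in>X. H' x z * H' y z) = 0" if xy: "x \<in> X" "y \<in> X" "x \<noteq> y" for x y
  proof -
    have mixed: "(\<Sum>z\<in>X. H' x z * H' y z) = 0" if x: "x \<in> S" and y: "y \<in> X - S" for x y
    proof -
      have "x \<noteq> y" "x \<in> X" using x y SX by auto
      have "(\<Sum>z\<in>X. H' x z * H' y z) =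
          (\<Sum>z\<in>X - S. (\<sigma> z / 2 - H x z) * H y z) + (\<Sum>z\<in>S. H x z * (\<sigma> y / 2 - H y z))"
        unfolding split using x y H'i H'o same by simp
      also have "\<dots> = (\<Sum>z\<in>X - S. \<sigma> z * H y z) / 2 - (\<Sum>z\<in>X - S. H x z * H y z)
          + \<sigma> y / 2 * (\<Sum>z\<in>S. H x z) - (\<Sum>z\<in>S. H x z * H y z)"
        by (simp add: algebra_simps sum_subtractf sum_distrib_left sum_divide_distrib)
      also have "\<dots> = 0"
        using \<sigma>_corr[of y] corr[of x y] d[OF x] \<open>x \<noteq> y\<close> \<open>x \<in> X\<close> y by simp
      finally show ?thesis .
    qed
    consider "x \<in> S" "y \<in> S" | "x \<in> S" "y \<in> X - S" | "x \<in> X - S" "y \<in> S" | "x \<in> X - S" "y \<in> X - S"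
      using xy by blast
    then show ?thesis
    proof cases
      case 1
      have "(\<Sum>z\<in>X - S. \<sigma> z * \<sigma> z) = (\<Sum>z\<in>X - S. \<Sum>u\<in>S. \<sigma> z * H u z)"
        by (intro sum.cong) (auto simp: \<sigma>_sym sum_distrib_left)
      also have "\<dots> = (\<Sum>u\<in>S. \<Sum>z\<in>X - S. \<sigma> z * H u z)" by (rule sum.swap)
      also have "\<dots> = (\<Sum>u\<in>S. n - d * d)"
        using SX \<sigma>_corr d by (intro sum.cong) (auto simp: \<sigma>_def)
      also have "\<dots> = 4 * (n - d * d)" using S by simp
      finally have \<sigma>\<sigma>: "(\<Sum>z\<in>X - S. \<sigma> z * \<sigma> z) = 4 * (n - d * d)" .
      have "(\<Sum>z\<in>X. H' x z * H' y z) =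
          (\<Sum>z\<in>X - S. (\<sigma> z / 2 - H x z) * (\<sigma> z / 2 - H y z)) + (\<Sum>z\<in>S. H x z * H y z)"
        unfolding split using 1 H'i same by simp
      also have "\<dots> = (\<Sum>z\<in>X - S. \<sigma> z * \<sigma> z) / 4 - (\<Sum>z\<in>X - S. \<sigma> z * H x z) / 2
          - (\<Sum>z\<in>X - S. \<sigma> z * H y z) / 2 + (\<Sum>z\<in>X - S. H x z * H y z) + (\<Sum>z\<in>S. H x z * H y z)"
        by (simp add: algebra_simps sum_subtractf sum.distrib sum_divide_distrib)
      also have "\<dots> = 0"
        using \<sigma>\<sigma> \<sigma>_corr[of x] \<sigma>_corr[of y] corr[of x y] d 1 xy by (simp add: \<sigma>_def diff_divide_distrib)
      finally show ?thesis .
    next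
      case 2
      then show ?thesis by (rule mixed)
    next
      case 3
      then show ?thesis using mixed[of y x] by (simp add: mult.commute)
    next
      case 4
      have "(\<Sum>z\<in>X. H' x z * H' y z) =
          (\<Sum>z\<in>X - S. H x z * H y z) + (\<Sum>z\<in>S. (\<sigma> x / 2 - H x z) * (\<sigma> y / 2 - H y z))"
        unfolding split using 4 H'o same by simp
      also have "(\<Sum>z\<in>S. (\<sigma> x / 2 - H x z) * (\<sigma> y / 2 - H y z)) =
          card S * (\<sigma> x * \<sigma> y / 4) - \<sigma> x / 2 * (\<Sum>z\<in>S. H y z) - \<sigma> y / 2 * (\<Sum>z\<in>S. H x z)
          + (\<Sum>z\<in>S. H x z * H y z)"
        by (simp add: algebra_simps sum_subtractf sum.distrib sum_distrib_left sum_divide_distrib)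
      also have "\<dots> = (\<Sum>z\<in>S. H x z * H y z)" using S by (simp add: \<sigma>_def)
      finally show ?thesis using corr[of x y] xy by simp
    qed
  qed
qed

text \<open>Each of the three perfect matchings of the 4-set has constant value, so the set induces
  a regular graph. A vertex outside has 0, 2 or 4 neighbours in it: for 2 the half row sum is 0 and
  all four signs flip, otherwise nothing changes. \<open>s\<close> is the indicator of the set and
  \<open>t\<close> that of the outer vertices with two neighbours; by parity three of the four
  values suffice to detect them.\<close>

lemma regular_hadamard_switch:
  assumes f: "regular_hadamard X f c"
    and abcd: "distinct [a, b, c', d]" "{a, b, c', d} \<subseteq> X"
    and inner: "f a b = f c' d" "f a c' = f b d" "f a d = f b c'"
    and even: "\<And>x. x \<in> X - {a, b, c', d} \<Longrightarrow> f a x + f b x + f c' x + f d x = 0"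
    and s: "\<And>x. x \<in> X \<Longrightarrow> s x = of_bool (x \<in> {a, b, c', d})"
    and t: "\<And>x. x \<in> X \<Longrightarrow> t x = of_bool (x \<notin> {a, b, c', d} \<and> (f a x \<noteq> f b x \<or> f a x \<noteq> f c' x))"
  shows "regular_hadamard X (\<lambda>x y. f x y + s x * t y + t x * s y) c"
    (is "regular_hadamard X ?g c")
proof -
  let ?S = "{a, b, c', d}"
  have X: "finite X" and alt: "alternating X f" using f by (auto simp: regular_hadamard_def)
  have sym: "f x y = f y x" if "x \<in> X" "y \<in> X" for x y
    using alt that by (auto simp: alternating_def)
  have st: "s x * t x = 0" if "x \<in> X" for x using s[OF that] t[OF that] by auto
  have alt': "alternating X ?g"
    using alt st by (auto simp: alternating_def algebra_simps)
  define H where "H x y = chi (f x y)" for x y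
  define H' where "H' x y = chi (?g x y)" for x y
  have S: "?S \<subseteq> X" "card ?S = 4" using abcd by auto
  have sumS: "(\<Sum>u\<in>?S. G u) = G a + G b + G c' + G d" for G :: "_ \<Rightarrow> real"
    using abcd(1) by simp
  have H_sym: "H x y = H y x" if "x \<in> X" "y \<in> X" for x y using sym that by (simp add: H_def)
  have orth: "(\<Sum>z\<in>X. H x z * H y z) = (if x = y then real (card X) else 0)" if "x \<in> X" "y \<in> X" for x y
    using f that by (auto simp: regular_hadamard_def H_def)
  have row: "(\<Sum>y\<in>X. H x y) = c" if "x \<in> X" for x
    using f that by (auto simp: regular_hadamard_def H_def)
  have "f b a = f a b" "f c' a = f a c'" "f c' b = f b c'" "f d a = f a d" "f d b = f b d" "f d c' = f c' d"
    "f a a = 0" "f b b = 0" "f c' c' = 0" "f d d = 0"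
    using alt abcd by (auto simp: alternating_def)
  \<comment> \<open>The summand 1 is the sign of the zero diagonal entry.\<close>
  then have d: "(\<Sum>u\<in>?S. H x u) = 1 + H a b + H a c' + H a d" if "x \<in> ?S" for x
    using that inner by (auto simp: sumS H_def)
  have out: "H' x y = (\<Sum>u\<in>?S. H x u) / 2 - H x y" if x: "x \<in> X - ?S" and y: "y \<in> ?S" for x y
  proof -
    have X': "x \<in> X" "y \<in> X" "a \<in> X" "b \<in> X" "c' \<in> X" "d \<in> X" using x y abcd by auto
    have fx: "f x a = f a x" "f x b = f b x" "f x c' = f c' x" "f x d = f d x"
      using sym X' by auto
    have g: "?g x y = f x y + t x" using s[of x] s[of y] X' x y by simp
    have tx: "t x = of_bool (f a x \<noteq> f b x \<or> f a x \<noteq> f c' x)" using t[of x] x by simp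
    have e: "f d x = f a x + f b x + f c' x"
      using even[OF x] by (cases "f a x"; cases "f b x"; cases "f c' x"; cases "f d x") auto
    show ?thesis
      unfolding H'_def g sumS unfolding H_def fx tx e
      using y fx e by (cases "f a x"; cases "f b x"; cases "f c' x") auto
  qed
  have out': "H' x y = H' y x" if "x \<in> ?S" "y \<in> X - ?S" for x y
    using sym[of x y] that S(1) by (auto simp: H'_def algebra_simps)
  have same: "H' x y = H x y" if "x \<in> X - ?S" "y \<in> X - ?S" for x y
    using s[of x] s[of y] that by (simp add: H'_def H_def)
  have same': "H' x y = H x y" if "x \<in> ?S" "y \<in> ?S" for x y
    using t[of x] t[of y] that S(1) by (auto simp: H'_def H_def)
  have "(\<Sum>z\<in>X. H' x z * H' y z) = 0" if "x \<in> X" "y \<in> X" "x \<noteq> y" for x y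
    using switching_orthogonal[OF X S H_sym orth row d out out' same same' that] .
  moreover have "(\<Sum>y\<in>X. H' x y) = c" if "x \<in> X" for x
    using switching_row_sum[OF X S H_sym orth row d out out' same same' that] .
  ultimately show ?thesis using X alt' by (simp add: regular_hadamard_def H'_def)
qed

subsection \<open>Switching sequences on 64 vertices\<close>

text \<open>Forms are stored as lists of Boolean rows so that the long switching sequences can be
  checked by evaluation. The operations below mostly traverse zipped lists, avoiding repeated
  indexing.\<close>

definition table_form :: "bool list list \<Rightarrow> nat \<Rightarrow> nat \<Rightarrow> bit" where
  "table_form M = (\<lambda>x y. of_bool (M ! x ! y))"

definition square_table :: "nat \<Rightarrow> bool list list \<Rightarrow> bool" where
  "square_table n M \<longleftrightarrow> length M = n \<and> (\<forall>r\<in>set M. length r = n)"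

definition xor_list :: "bool list \<Rightarrow> bool list \<Rightarrow> bool list" where
  "xor_list r s = map (\<lambda>(x, y). x \<noteq> y) (zip r s)"

fun indicator_list :: "nat \<Rightarrow> nat \<times> nat \<times> nat \<times> nat \<Rightarrow> bool list" where
  "indicator_list n (a, b, c, d) = map (\<lambda>i. i = a \<or> i = b \<or> i = c \<or> i = d) [0..<n]"

fun toggle_list :: "bool list list \<Rightarrow> nat \<times> nat \<times> nat \<times> nat \<Rightarrow> bool list \<Rightarrow> bool list" where
  "toggle_list M (a, b, c, d) s =
     map (\<lambda>(s, u, v, w). \<not> s \<and> (u \<noteq> v \<or> u \<noteq> w)) (zip s (zip (M ! a) (zip (M ! b) (M ! c))))"

definition update_table :: "bool list \<Rightarrow> bool list \<Rightarrow> bool list list \<Rightarrow> bool list list" where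
  "update_table s t M =
     map (\<lambda>(p, q, r). if p then xor_list r t else if q then xor_list r s else r) (zip s (zip t M))"

definition switch_table :: "nat \<Rightarrow> bool list list \<Rightarrow> nat \<times> nat \<times> nat \<times> nat \<Rightarrow> bool list list" where
  "switch_table n M S =
     update_table (indicator_list n S) (toggle_list M S (indicator_list n S)) M"

fun switchable :: "nat \<Rightarrow> bool list list \<Rightarrow> nat \<times> nat \<times> nat \<times> nat \<Rightarrow> bool" where
  "switchable n M (a, b, c, d) \<longleftrightarrow> a < b \<and> b < c \<and> c < d \<and> d < n \<and>
     M ! a ! b = M ! c ! d \<and> M ! a ! c = M ! b ! d \<and> M ! a ! d = M ! b ! c \<and>
     list_all (\<lambda>(s, u, v, w, x). s \<or> (u = v) = (w = x))
       (zip (indicator_list n (a, b, c, d)) (zip (M ! a) (zip (M ! b) (zip (M ! c) (M ! d)))))"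

fun rows_sum_to_one :: "nat \<Rightarrow> bool list list \<Rightarrow> nat \<times> nat \<times> nat \<times> nat \<Rightarrow> bool" where
  "rows_sum_to_one n M (a, b, c, d) \<longleftrightarrow> a < b \<and> b < c \<and> c < d \<and> d < n \<and>
     list_all (\<lambda>(u, v, w, x). (u = v) \<noteq> (w = x)) (zip (M ! a) (zip (M ! b) (zip (M ! c) (M ! d))))"

text \<open>The table version of splitting off the pivot \<open>(p, q)\<close>: row \<open>x\<close>
  receives row \<open>q\<close> if \<open>M ! p ! x\<close> holds, and row \<open>p\<close> if
  \<open>M ! q ! x\<close> holds.\<close>

definition split_table :: "bool list list \<Rightarrow> nat \<Rightarrow> nat \<Rightarrow> bool list list" where
  "split_table M p q =
     map (\<lambda>(u, v, r). if u then (if v then xor_list r (xor_list (M ! p) (M ! q)) else xor_list r (M ! q))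
                      else if v then xor_list r (M ! p) else r) (zip (M ! p) (zip (M ! q) M))"

fun splits :: "nat \<Rightarrow> bool list list \<Rightarrow> (nat \<times> nat) list \<Rightarrow> bool" where
  "splits n M [] \<longleftrightarrow> True"
| "splits n M ((p, q) # ps) \<longleftrightarrow> p < n \<and> q < n \<and> M ! p ! q \<and> splits n (split_table M p q) ps"

text \<open>The all-one condition is checked at every stage with the same four rows
  \<open>z\<close>, since any stage may be the one with the desired rank. The pivots
  \<open>ps\<close> certify only the rank of the last table.\<close>

fun switching_sequence ::
  "nat \<Rightarrow> nat \<times> nat \<times> nat \<times> nat \<Rightarrow> (nat \<times> nat) list \<Rightarrow> bool list list \<Rightarrow> (nat \<times> nat \<times> nat \<times> nat) list \<Rightarrow> bool"
where
  "switching_sequence n z ps M [] \<longleftrightarrow> rows_sum_to_one n M z \<and> splits n M ps"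
| "switching_sequence n z ps M (S # Ss) \<longleftrightarrow>
     rows_sum_to_one n M z \<and> switchable n M S \<and> switching_sequence n z ps (switch_table n M S) Ss"

section \<open>Correctness of the table operations\<close>

lemma length_xor_list: "length r = n \<Longrightarrow> length s = n \<Longrightarrow> length (xor_list r s) = n"
  by (simp add: xor_list_def)

lemma nth_xor_list:
  "i < n \<Longrightarrow> length r = n \<Longrightarrow> length s = n \<Longrightarrow> xor_list r s ! i \<longleftrightarrow> r ! i \<noteq> s ! i"
  by (simp add: xor_list_def)

lemma square_tableD:
  assumes "square_table n M"
  shows "length M = n" "x < n \<Longrightarrow> length (M ! x) = n"
  using assms by (auto simp: square_table_def)

lemma square_tableI:
  assumes "length M = n" "\<And>x. x < n \<Longrightarrow> length (M ! x) = n"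
  shows "square_table n M"
  using assms by (auto simp: square_table_def in_set_conv_nth)

lemma of_bool_bit_simps:
  "of_bool (p \<noteq> q) = (of_bool p + of_bool q :: bit)" "of_bool (p \<and> q) = (of_bool p * of_bool q :: bit)"
  by (cases p; cases q; simp)+

text \<open>Disjoint supports mean that at most one of the two correction terms touches a given row;
  hence the three cases in \<open>update_table\<close>.\<close>

lemma update_table:
  assumes M: "square_table n M" and s: "length s = n" and t: "length t = n"
    and disj: "\<And>x. x < n \<Longrightarrow> \<not> (s ! x \<and> t ! x)"
  shows "square_table n (update_table s t M)"
    and "x < n \<Longrightarrow> y < n \<Longrightarrow> table_form (update_table s t M) x y =
      table_form M x y + of_bool (s ! x) * of_bool (t ! y) + of_bool (t ! x) * of_bool (s ! y)"
proof -
  note len = square_tableD[OF M]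
  have row: "update_table s t M ! x =
      (if s ! x then xor_list (M ! x) t else if t ! x then xor_list (M ! x) s else M ! x)" if "x < n" for x
    using that len(1) s t by (simp add: update_table_def)
  show "square_table n (update_table s t M)"
    using len s t by (intro square_tableI) (auto simp: row length_xor_list, simp add: update_table_def)
  show "table_form (update_table s t M) x y =
      table_form M x y + of_bool (s ! x) * of_bool (t ! y) + of_bool (t ! x) * of_bool (s ! y)"
    if "x < n" "y < n"
    using that len s t disj[OF that(1)]
    by (auto simp: table_form_def row nth_xor_list[of _ n] of_bool_bit_simps)
qed

lemma switch_table:
  assumes M: "square_table n M" and f: "regular_hadamard {..<n} (table_form M) c"
    and S: "switchable n M S"
  shows "square_table n (switch_table n M S)"
    and "regular_hadamard {..<n} (table_form (switch_table n M S)) c"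
    and "card (row_span {..<n} (table_form (switch_table n M S))) \<le> 4 * card (row_span {..<n} (table_form M))"
proof -
  obtain a b c' d where S_eq: "S = (a, b, c', d)" by (metis surj_pair)
  have lt: "a < b" "b < c'" "c' < d" "d < n" using S by (auto simp: S_eq)
  note len = square_tableD[OF M]
  define s where "s = indicator_list n S"
  define t where "t = toggle_list M S s"
  have ls: "length s = n" by (simp add: s_def S_eq)
  have lt': "length t = n" using ls len lt by (simp add: t_def S_eq)
  have sx: "s ! x \<longleftrightarrow> x \<in> {a, b, c', d}" if "x < n" for x using that by (simp add: s_def S_eq)
  have tx: "t ! x \<longleftrightarrow> \<not> s ! x \<and> (M ! a ! x \<noteq> M ! b ! x \<or> M ! a ! x \<noteq> M ! c' ! x)" if "x < n" for x
    using that ls len lt by (simp add: t_def S_eq)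
  have upd: "switch_table n M S = update_table s t M" by (simp add: switch_table_def s_def t_def)
  have disj: "\<not> (s ! x \<and> t ! x)" if "x < n" for x using tx[OF that] by simp
  show "square_table n (switch_table n M S)"
    unfolding upd using M ls lt' disj by (rule update_table(1))
  define g where "g = (\<lambda>x y. table_form M x y + of_bool (s ! x) * of_bool (t ! y) + of_bool (t ! x) * of_bool (s ! y))"
  have g: "table_form (switch_table n M S) x y = g x y" if "x \<in> {..<n}" "y \<in> {..<n}" for x y
    unfolding upd g_def using update_table(2)[OF M ls lt' disj] that by simp
  have even: "table_form M a x + table_form M b x + table_form M c' x + table_form M d x = 0"
    if x: "x \<in> {..<n} - {a, b, c', d}" for x
  proof -
    have "x < n" "\<not> s ! x" using x sx by auto
    have "\<forall>i<n. s ! i \<or> (M ! a ! i = M ! b ! i) = (M ! c' ! i = M ! d ! i)"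
      using S len lt ls by (simp add: S_eq list_all_length s_def)
    then have "(M ! a ! x = M ! b ! x) = (M ! c' ! x = M ! d ! x)" using \<open>x < n\<close> \<open>\<not> s ! x\<close> by blast
    then show ?thesis by (auto simp: table_form_def)
  qed
  have "regular_hadamard {..<n} g c"
    unfolding g_def
  proof (rule regular_hadamard_switch[OF f _ _ _ _ _ even])
    show "distinct [a, b, c', d]" "{a, b, c', d} \<subseteq> {..<n}" using lt by auto
    show "table_form M a b = table_form M c' d" "table_form M a c' = table_form M b d"
      "table_form M a d = table_form M b c'"
      using S by (auto simp: S_eq table_form_def)
  qed (auto simp: sx tx table_form_def)
  then show "regular_hadamard {..<n} (table_form (switch_table n M S)) c"
    using g by (simp add: regular_hadamard_def alternating_def)
  have "row_span {..<n} (table_form (switch_table n M S)) = row_span {..<n} g"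
    using g by (rule row_span_cong)
  then show "card (row_span {..<n} (table_form (switch_table n M S))) \<le> 4 * card (row_span {..<n} (table_form M))"
    unfolding g_def using card_row_span_update_le[of "{..<n}" "table_form M"] by simp
qed

lemma rows_sum_to_one:
  assumes M: "square_table n M" and z: "rows_sum_to_one n M z"
  shows "\<exists>z\<subseteq>{..<n}. even (card z) \<and> (\<forall>y\<in>{..<n}. (\<Sum>u\<in>z. table_form M u y) = 1)"
proof -
  obtain a b c d where z_eq: "z = (a, b, c, d)" by (metis surj_pair)
  have lt: "a < b" "b < c" "c < d" "d < n" using z by (auto simp: z_eq)
  note len = square_tableD[OF M]
  show ?thesis
  proof (intro exI[of _ "{a, b, c, d}"] conjI ballI)
    show "{a, b, c, d} \<subseteq> {..<n}" "even (card {a, b, c, d})" using lt by auto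
    fix y assume "y \<in> {..<n}"
    then have "(M ! a ! y = M ! b ! y) \<noteq> (M ! c ! y = M ! d ! y)"
      using z len lt by (simp add: z_eq list_all_length)
    then have "table_form M a y + (table_form M b y + (table_form M c y + table_form M d y)) = 1"
      by (auto simp: table_form_def)
    then show "(\<Sum>u\<in>{a, b, c, d}. table_form M u y) = 1" using lt by simp
  qed
qed

lemma split_table:
  assumes M: "square_table n M" and pq: "p < n" "q < n"
  shows "square_table n (split_table M p q)"
    and "x < n \<Longrightarrow> y < n \<Longrightarrow> table_form (split_table M p q) x y = table_form M x y
      + table_form M p x * table_form M q y + table_form M q x * table_form M p y"
proof -
  note len = square_tableD[OF M]
  have row: "split_table M p q ! x =
      (if M ! p ! x then (if M ! q ! x then xor_list (M ! x) (xor_list (M ! p) (M ! q)) else xor_list (M ! x) (M ! q))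
       else if M ! q ! x then xor_list (M ! x) (M ! p) else M ! x)" if "x < n" for x
    using that len pq by (simp add: split_table_def)
  show "square_table n (split_table M p q)"
    using len pq by (intro square_tableI) (auto simp: row length_xor_list, simp add: split_table_def)
  show "table_form (split_table M p q) x y = table_form M x y
      + table_form M p x * table_form M q y + table_form M q x * table_form M p y" if "x < n" "y < n"
    using that len pq
    by (auto simp: table_form_def row nth_xor_list[of _ n] length_xor_list)
qed

text \<open>Every valid pivot accounts for a factor of 4, and what remains is nonempty.\<close>

lemma splits_card_row_span:
  assumes "square_table n M" "alternating {..<n} (table_form M)" "splits n M ps"
  shows "4 ^ length ps \<le> card (row_span {..<n} (table_form M))"
  using assms
proof (induction ps arbitrary: M)
  case Nil
  then show ?case using card_row_span_pos[of "{..<n}" "table_form M"] by simp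
next
  case (Cons pq ps)
  obtain p q where pq: "pq = (p, q)" by (cases pq)
  with Cons.prems have lt: "p < n" "q < n" "M ! p ! q" and sp: "splits n (split_table M p q) ps" by auto
  let ?f = "table_form M"
  let ?g = "\<lambda>x y. ?f x y + ?f p x * ?f q y + ?f q x * ?f p y"
  note split = split_table[OF Cons.prems(1) lt(1,2)]
  have "alternating {..<n} (table_form (split_table M p q))"
    using alternating_split[OF Cons.prems(2), of p q] lt split(2) by (simp add: alternating_def)
  then have "4 ^ length ps \<le> card (row_span {..<n} (table_form (split_table M p q)))"
    using Cons.IH split(1) sp by blast
  also have "row_span {..<n} (table_form (split_table M p q)) = row_span {..<n} ?g"
    using split(2) by (intro row_span_cong) auto
  finally show ?case
    using card_row_span_split_pair[OF _ Cons.prems(2), of p q] lt by (simp add: pq table_form_def)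
qed

text \<open>Each switching multiplies the size of the row space by at most 4, and that size is always a
  power of 4; hence no power of 4 between the first and the last size is skipped.\<close>

lemma switching_sequence_hadamard_rank:
  assumes "square_table n M" "regular_hadamard {..<n} (table_form M) c"
    "switching_sequence n z ps M Ss" "card (row_span {..<n} (table_form M)) \<le> 4 ^ Suc k" "Suc k \<le> length ps"
  shows "\<exists>M'. hadamard_rank {..<n} (table_form M') c k"
  using assms
proof (induction Ss arbitrary: M)
  case Nil
  have alt: "alternating {..<n} (table_form M)" using Nil.prems(2) by (simp add: regular_hadamard_def)
  have "4 ^ length ps \<le> card (row_span {..<n} (table_form M))"
    using splits_card_row_span[OF Nil.prems(1) alt, of ps] Nil.prems(3) by simp
  moreover have "(4::nat) ^ Suc k \<le> 4 ^ length ps"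
    using Nil.prems(5) by (intro power_increasing) auto
  \<comment> \<open>At the end of the sequence the pivots bound the size from below and the
    invariant bounds it from above.\<close>
  ultimately have "card (row_span {..<n} (table_form M)) = 4 ^ Suc k"
    using Nil.prems(4) by linarith
  then show ?case
    using Nil.prems rows_sum_to_one[of n M z] by (auto simp: hadamard_rank_def)
next
  case (Cons S Ss)
  have alt: "alternating {..<n} (table_form M)" using Cons.prems(2) by (simp add: regular_hadamard_def)
  then obtain j where j: "card (row_span {..<n} (table_form M)) = 4 ^ j"
    using card_row_span_alternating[of "{..<n}"] by auto
  show ?case
  proof (cases "j = Suc k")
    case True
    then show ?thesis
      using Cons.prems j rows_sum_to_one[of n M z] by (auto simp: hadamard_rank_def)
  next
    case False
    \<comment> \<open>The target is not yet reached, so one more factor of 4 does not overshoot it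
      and the invariant passes to the next table.\<close>
    have "j \<le> Suc k" using Cons.prems(4) unfolding j by (rule power_le_imp_le_exp[rotated]) simp
    with False have "Suc j \<le> Suc k" by simp
    then have "(4::nat) ^ Suc j \<le> 4 ^ Suc k" by (rule power_increasing) simp
    moreover have S: "switchable n M S" using Cons.prems by simp
    moreover have "card (row_span {..<n} (table_form (switch_table n M S))) \<le> 4 ^ Suc j"
      using switch_table(3)[OF Cons.prems(1,2) S] j by simp
    ultimately have "card (row_span {..<n} (table_form (switch_table n M S))) \<le> 4 ^ Suc k"
      by linarith
    then show ?thesis
      using Cons.IH[of "switch_table n M S"] switch_table(1,2)[OF Cons.prems(1,2) S] Cons.prems by simp
  qed
qed

section \<open>Forms of order 4 and 64\<close>

lemma lessThan_4: "{..<4::nat} = {0, 1, 2, 3}"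
  by auto

text \<open>The row sum is 1 - 3. The pivots (0, 1) and (2, 3) exhaust the form, and all four rows
  together sum to the all-one vector.\<close>

lemma hadamard_rank_K4: "hadamard_rank {..<4::nat} (\<lambda>x y. of_bool (x \<noteq> y)) (- 2) 1"
  unfolding hadamard_rank_def
proof (intro conjI)
  let ?f = "\<lambda>x y :: nat. of_bool (x \<noteq> y) :: bit"
  let ?g = "\<lambda>x y. ?f x y + ?f 0 x * ?f 1 y + ?f 1 x * ?f 0 y"
  have alt: "alternating {..<4} ?f" by (auto simp: alternating_def)
  show "regular_hadamard {..<4} ?f (- 2)"
    using alt by (simp add: regular_hadamard_def lessThan_4)
  have "card (row_span {..<4} ?f) = 4 * card (row_span {..<4} ?g)"
    using alt by (intro card_row_span_split_pair) auto
  also have "card (row_span {..<4} ?g) = 4 * card (row_span {..<4}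
      (\<lambda>x y. ?g x y + ?g 2 x * ?g 3 y + ?g 3 x * ?g 2 y))"
    using alternating_split[OF alt, of 0 1] by (intro card_row_span_split_pair) auto
  also have "card (row_span {..<4} (\<lambda>x y. ?g x y + ?g 2 x * ?g 3 y + ?g 3 x * ?g 2 y)) = 1"
    by (intro card_row_span_zero) (auto simp: lessThan_4)
  finally show "card (row_span {..<4} ?f) = 4 ^ Suc 1" by simp
  show "\<exists>z\<subseteq>{..<4}. even (card z) \<and> (\<forall>y\<in>{..<4}. (\<Sum>u\<in>z. ?f u y) = 1)"
    by (intro exI[of _ "{..<4}"]) (simp add: lessThan_4)
qed

text \<open>The edges join 0 to 3 and 1 to 2, and serve as the two pivots. The row sum 3 - 1 has the
  sign opposite to that of the complete graph.\<close>

lemma hadamard_rank_2K2: "hadamard_rank {..<4::nat} (\<lambda>x y. of_bool (x + y = 3)) 2 1"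
  unfolding hadamard_rank_def
proof (intro conjI)
  let ?f = "\<lambda>x y :: nat. of_bool (x + y = 3) :: bit"
  let ?g = "\<lambda>x y. ?f x y + ?f 0 x * ?f 3 y + ?f 3 x * ?f 0 y"
  have alt: "alternating {..<4} ?f" by (auto simp: alternating_def lessThan_4)
  show "regular_hadamard {..<4} ?f 2"
    using alt by (simp add: regular_hadamard_def lessThan_4)
  have "card (row_span {..<4} ?f) = 4 * card (row_span {..<4} ?g)"
    using alt by (intro card_row_span_split_pair) auto
  also have "card (row_span {..<4} ?g) = 4 * card (row_span {..<4}
      (\<lambda>x y. ?g x y + ?g 1 x * ?g 2 y + ?g 2 x * ?g 1 y))"
    using alternating_split[OF alt, of 0 3] by (intro card_row_span_split_pair) auto
  also have "card (row_span {..<4} (\<lambda>x y. ?g x y + ?g 1 x * ?g 2 y + ?g 2 x * ?g 1 y)) = 1"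
    by (intro card_row_span_zero) (auto simp: lessThan_4)
  finally show "card (row_span {..<4} ?f) = 4 ^ Suc 1" by simp
  show "\<exists>z\<subseteq>{..<4}. even (card z) \<and> (\<forall>y\<in>{..<4}. (\<Sum>u\<in>z. ?f u y) = 1)"
    by (intro exI[of _ "{..<4}"]) (simp add: lessThan_4)
qed

text \<open>The triple \<open>((a, b), c)\<close> gets the number \<open>a + 4 * b + 16 * c\<close>;
  the switching sets and pivots below refer to this numbering.\<close>

definition vertices64 :: "((nat \<times> nat) \<times> nat) list" where
  "vertices64 = [((a, b), c). c \<leftarrow> [0, 1, 2, 3], b \<leftarrow> [0, 1, 2, 3], a \<leftarrow> [0, 1, 2, 3]]"

definition table64 :: "(nat \<Rightarrow> nat \<Rightarrow> bool) \<Rightarrow> bool list list" where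
  "table64 h = map (\<lambda>((a, b), c). map (\<lambda>((a', b'), c'). (a \<noteq> a') \<noteq> ((b \<noteq> b') \<noteq> h c c')) vertices64) vertices64"

lemma vertices64:
  "length vertices64 = 64" "distinct vertices64" "set vertices64 = ({..<4} \<times> {..<4}) \<times> {..<4}"
  by (simp_all add: vertices64_def lessThan_4) auto

lemma square_table64: "square_table 64 (table64 h)"
  by (auto simp: square_table_def table64_def vertices64(1))

text \<open>The table is the direct sum of two complete graphs and \<open>h\<close>. The two factors
  \<open>- 2\<close> have product 4, so \<open>h\<close> decides the sign of the row sum.\<close>

lemma hadamard_rank_table64:
  assumes "hadamard_rank {..<4} (\<lambda>x y. of_bool (h x y)) d 1"
  shows "hadamard_rank {..<64} (table_form (table64 h)) (4 * d) 3"
proof -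
  let ?K = "\<lambda>x y :: nat. of_bool (x \<noteq> y) :: bit"
  let ?F = "form_sum (form_sum ?K ?K) (\<lambda>x y. of_bool (h x y))"
  have "hadamard_rank (({..<4} \<times> {..<4}) \<times> {..<4}) ?F ((- 2) * (- 2) * d) (1 + 1 + 1)"
    using assms by (intro hadamard_rank_form_sum hadamard_rank_K4)
  moreover have "bij_betw ((!) vertices64) {..<64} (({..<4} \<times> {..<4}) \<times> {..<4})"
    using vertices64 by (intro bij_betw_nth) auto
  ultimately have "hadamard_rank {..<64} (\<lambda>i j. ?F (vertices64 ! i) (vertices64 ! j)) ((- 2) * (- 2) * d) (1 + 1 + 1)"
    by (rule hadamard_rank_reindex)
  then have "hadamard_rank {..<64} (table_form (table64 h)) ((- 2) * (- 2) * d) (1 + 1 + 1)"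
    by (rule hadamard_rank_cong)
      (auto simp: table_form_def table64_def vertices64(1) form_sum_def case_prod_unfold of_bool_bit_simps(1) add.assoc
        simp del: of_bool_not_iff)
  moreover have "(- 2) * (- 2) * d = 4 * d" "1 + 1 + 1 = (3::nat)" by simp_all
  ultimately show ?thesis by (simp only:)
qed

text \<open>The sequences were found by a random search that prefers switchings increasing the rank.
  The pairs are the pivots of a symplectic Gaussian elimination of the last table.\<close>

lemma switching_sequence_neg:
  "switching_sequence 64 (20, 21, 22, 23)
    [(0, 1), (2, 4), (3, 6), (5, 7), (8, 11), (9, 10), (12, 15), (13, 14), (16, 18), (19, 20),
     (21, 24), (22, 29), (23, 33)]
    (table64 (\<lambda>c c'. c \<noteq> c'))
    [(1, 3, 61, 63), (21, 22, 49, 50), (12, 18, 40, 54), (5, 30, 34, 57), (5, 29, 33, 57), (10, 14, 42, 46),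
     (0, 24, 38, 62), (32, 35, 56, 59), (5, 30, 33, 58), (4, 29, 30, 59), (11, 12, 40, 47), (12, 42, 49, 51)]"
  by code_simp

lemma switching_sequence_pos:
  "switching_sequence 64 (0, 3, 13, 14)
    [(0, 4), (1, 2), (3, 6), (5, 7), (8, 9), (10, 11), (12, 18), (13, 32), (14, 35), (16, 36),
     (33, 34), (37, 39), (42, 43)]
    (table64 (\<lambda>c c'. c + c' = 3))
    [(35, 40, 53, 62), (2, 11, 18, 27), (6, 17, 36, 51), (3, 13, 19, 29), (33, 38, 59, 60), (32, 45, 55, 58),
     (39, 45, 48, 58), (7, 16, 47, 56), (1, 6, 17, 22), (5, 9, 20, 24), (34, 41, 52, 63), (6, 17, 34, 40)]"
  by code_simp

lemma hadamard_rank_64: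
  assumes "hadamard_rank {..<4} (\<lambda>x y. of_bool (h x y)) d 1" "switching_sequence 64 z ps (table64 h) Ss"
    "3 \<le> k" "Suc k \<le> length ps"
  shows "\<exists>f. hadamard_rank {..<64::nat} f (4 * d) k"
proof -
  have base: "hadamard_rank {..<64} (table_form (table64 h)) (4 * d) 3"
    using assms(1) by (rule hadamard_rank_table64)
  have "(4::nat) ^ Suc 3 \<le> 4 ^ Suc k" using assms(3) by (intro power_increasing) auto
  then have "card (row_span {..<64} (table_form (table64 h))) \<le> 4 ^ Suc k"
    using base unfolding hadamard_rank_def by linarith
  then show ?thesis
    using switching_sequence_hadamard_rank[OF square_table64 _ assms(2) _ assms(4)] base
    unfolding hadamard_rank_def by blast
qed

subsection \<open>All dimensions\<close>

text \<open>\<open>\<epsilon>\<close> is the sign of the row sum, and \<open>2 * k\<close> is the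
  rank of the normalised form, two less than that of \<open>f\<close>.\<close>

definition realisable :: "nat \<Rightarrow> real \<Rightarrow> nat \<Rightarrow> bool" where
  "realisable m \<epsilon> k \<longleftrightarrow> (\<exists>f. hadamard_rank {..<4 ^ m :: nat} f (\<epsilon> * 2 ^ m) k)"

lemma realisable_add:
  assumes "realisable m \<epsilon> k" "realisable n \<delta> l"
  shows "realisable (m + n) (\<epsilon> * \<delta>) (k + l)"
proof -
  obtain f g where "hadamard_rank {..<4 ^ m :: nat} f (\<epsilon> * 2 ^ m) k"
    "hadamard_rank {..<4 ^ n :: nat} g (\<delta> * 2 ^ n) l"
    using assms by (auto simp: realisable_def)
  then have "hadamard_rank ({..<4 ^ m :: nat} \<times> {..<4 ^ n :: nat}) (form_sum f g)
      (\<epsilon> * 2 ^ m * (\<delta> * 2 ^ n)) (k + l)"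
    by (rule hadamard_rank_form_sum)
  moreover obtain h where "bij_betw h {..<4 ^ (m + n) :: nat} ({..<4 ^ m :: nat} \<times> {..<4 ^ n :: nat})"
    using finite_same_card_bij[of "{..<4 ^ (m + n) :: nat}" "{..<4 ^ m :: nat} \<times> {..<4 ^ n :: nat}"]
    by (auto simp: card_cartesian_product power_add)
  ultimately have "hadamard_rank {..<4 ^ (m + n) :: nat} (\<lambda>i j. form_sum f g (h i) (h j))
      (\<epsilon> * 2 ^ m * (\<delta> * 2 ^ n)) (k + l)"
    by (rule hadamard_rank_reindex)
  moreover have "\<epsilon> * 2 ^ m * (\<delta> * 2 ^ n) = \<epsilon> * \<delta> * 2 ^ (m + n)" by (simp add: power_add)
  ultimately show ?thesis unfolding realisable_def by metis
qed

lemma realisable_1: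
  assumes "\<epsilon> \<in> {1, - 1}"
  shows "realisable 1 \<epsilon> 1"
  using assms hadamard_rank_K4 hadamard_rank_2K2 by (auto simp: realisable_def)

text \<open>The direct sum of three forms of order 4 starts at 3. The 13 pivots put the last table
  at 12 or beyond, and no value in between is skipped.\<close>

lemma realisable_3:
  assumes "\<epsilon> \<in> {1, - 1}" "3 \<le> k" "k \<le> 12"
  shows "realisable 3 \<epsilon> k"
  using assms hadamard_rank_64[OF hadamard_rank_K4 switching_sequence_neg, of k]
    hadamard_rank_64[OF hadamard_rank_2K2 switching_sequence_pos, of k]
  by (auto simp: realisable_def)

text \<open>Induction peels off one block of order 64 at a time. Such a block contributes any value
  from 3 to 12, whence the gain of 9 for each block.\<close>

lemma realisable:
  assumes "m \<ge> 1" "\<epsilon> \<in> {1, - 1}" "m \<le> k" "k \<le> m + 9 * (m div 3)"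
  shows "realisable m \<epsilon> k"
  using assms
proof (induction m arbitrary: k rule: less_induct)
  case (less m)
  consider "m = 1" | "m = 2" | "m = 3" | "m > 3" using less.prems(1) by linarith
  then show ?case
  proof cases
    case 1
    with less.prems have "k = 1" by simp
    then show ?thesis using 1 realisable_1 less.prems by simp
  next
    case 2
    with less.prems have k: "k = 2" by simp
    have "realisable (1 + 1) (1 * \<epsilon>) (1 + 1)"
      using less.prems(2) by (intro realisable_add realisable_1) auto
    then show ?thesis unfolding 2 k by (simp only: one_add_one mult_1)
  next
    case 3
    then show ?thesis using realisable_3 less.prems by simp
  next
    case 4
    define n where "n = m - 3"
    have n: "m = n + 3" "n \<ge> 1" using 4 by (auto simp: n_def)
    \<comment> \<open>The block takes as much of \<open>k\<close> as it can, while at least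
      \<open>n\<close> is left for the remaining part.\<close>
    define j where "j = min (k - n) 12"
    have "m div 3 = n div 3 + 1" using n by simp
    then have "3 \<le> j" "j \<le> 12" "n \<le> k - j" "k - j \<le> n + 9 * (n div 3)" "j \<le> k"
      using less.prems n by (auto simp: j_def)
    \<comment> \<open>The smaller part carries the sign, so the block is used with positive
      sign.\<close>
    then have "realisable (n + 3) (\<epsilon> * 1) (k - j + j)"
      using less.IH[of n "k - j"] n less.prems(2) realisable_3[of 1 j] by (intro realisable_add) auto
    then show ?thesis using n \<open>j \<le> k\<close> by simp
  qed
qed

subsection \<open>Ranks and strongly regular graphs\<close>

text \<open>Coordinates with respect to a basis \<open>B\<close> identify the space with the
  functions from \<open>B\<close> to the field.\<close>

lemma (in vectorspace) card_carrier_eq_power_dim: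
  assumes "fin_dim" "finite (carrier K)"
  shows "card (carrier V) = card (carrier K) ^ dim"
proof -
  obtain B where B: "finite B" "basis B" using finite_basis_exists[OF assms(1)] by blast
  then have BV: "B \<subseteq> carrier V" by (auto simp: basis_def)
  have ex1: "\<exists>!a. a \<in> B \<rightarrow>\<^sub>E carrier K \<and> lincomb a B = v" if "v \<in> carrier V" for v
    using basis_criterion[OF B(1) BV] B(2) that by blast
  have closed: "lincomb a B \<in> carrier V" if "a \<in> B \<rightarrow>\<^sub>E carrier K" for a
    using that BV B(1) by (intro lincomb_closed) auto
  have "inj_on (\<lambda>a. lincomb a B) (B \<rightarrow>\<^sub>E carrier K)"
    using ex1 closed by (intro inj_onI) metis
  moreover have "(\<lambda>a. lincomb a B) ` (B \<rightarrow>\<^sub>E carrier K) = carrier V"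
    using ex1 closed by blast
  ultimately have "bij_betw (\<lambda>a. lincomb a B) (B \<rightarrow>\<^sub>E carrier K) (carrier V)"
    by (simp add: bij_betw_def)
  then have "card (carrier V) = card (B \<rightarrow>\<^sub>E carrier K)" by (simp add: bij_betw_same_card)
  then show ?thesis using B dim_basis by (simp add: card_PiE)
qed

text \<open>The library defines the rank as the dimension of the column span. By symmetry columns
  are rows, so that span corresponds to \<open>row_span\<close> under \<open>vec n\<close>.\<close>

lemma card_row_span_eq_power_rank:
  fixes f :: "nat \<Rightarrow> nat \<Rightarrow> bit"
  assumes f: "alternating {..<n} f"
  shows "card (row_span {..<n} f) = 2 ^ vec_space.rank n (mat n n (\<lambda>(i, j). f i j))"
proof -
  interpret vec_space "TYPE(bit)" n .
  define A where "A = mat n n (\<lambda>(i, j). f i j)"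
  let ?C = "set (cols A)"
  have A: "A \<in> carrier_mat n n" by (simp add: A_def)
  have C: "?C \<subseteq> carrier_vec n" using cols_dim A by blast
  have sub: "LinearCombinations.submodule class_ring (span ?C) V"
    using C by (intro span_is_submodule) simp
  interpret W: vectorspace class_ring "span_vs ?C"
    using C by (intro subspace_is_vs span_is_subspace) simp
  have CW: "?C \<subseteq> span ?C" using C by (intro in_own_span) simp
  have "W.fin_dim"
    unfolding W.fin_dim_def using CW span_li_not_depend(1)[OF CW sub]
    by (intro exI[of _ ?C]) simp
  moreover have "finite (carrier (class_ring :: bit ring))" "card (carrier (class_ring :: bit ring)) = 2"
    by (simp_all add: class_ring_simps UNIV_bit)
  ultimately have "card (span ?C) = 2 ^ rank A"
    using W.card_carrier_eq_power_dim by (simp add: rank_def)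
  moreover have "span ?C = vec n ` row_span {..<n} f"
  proof
    let ?R = "row_span {..<n} f"
    have R: "add_closed ?R" by (simp add: add_closed_row_span)
    have col: "col A j = vec n (\<lambda>i. if i \<in> {..<n} then f j i else 0)" if "j < n" for j
      using f that by (auto simp: A_def alternating_def)
    have "LinearCombinations.submodule class_ring (vec n ` ?R) V"
    proof (rule LinearCombinations.submodule.intro)
      show "module class_ring V" by (rule module_axioms)
      show "vec n ` ?R \<subseteq> carrier V" by auto
      show "\<zero>\<^bsub>V\<^esub> \<in> vec n ` ?R"
      proof -
        have "\<zero>\<^bsub>V\<^esub> = vec n (\<lambda>_. 0 :: bit)" by (auto simp: module_vec_simps)
        then show ?thesis using R by (auto simp: add_closed_def)
      qed
      show "v \<oplus>\<^bsub>V\<^esub> w \<in> vec n ` ?R" if vw: "v \<in> vec n ` ?R" "w \<in> vec n ` ?R" for v w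
      proof -
        obtain v' w' where *: "v' \<in> ?R" "w' \<in> ?R" "v = vec n v'" "w = vec n w'" using vw by auto
        then have "v \<oplus>\<^bsub>V\<^esub> w = vec n (\<lambda>y. v' y + w' y)" by (auto simp: module_vec_simps)
        then show ?thesis using add_closedD[OF R *(1,2)] by auto
      qed
      show "c \<odot>\<^bsub>V\<^esub> v \<in> vec n ` ?R" if cv: "c \<in> carrier class_ring" "v \<in> vec n ` ?R" for c v
      proof -
        obtain v' where *: "v' \<in> ?R" "v = vec n v'" using cv by auto
        then have "c \<odot>\<^bsub>V\<^esub> v = vec n (\<lambda>y. c * v' y)" by (auto simp: module_vec_simps)
        then show ?thesis using add_closed_scale[OF R *(1)] by auto
      qed
    qed
    moreover have "?C \<subseteq> vec n ` ?R"
    proof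
      fix v assume "v \<in> ?C"
      then obtain j where "j < n" "v = col A j" using A by (auto simp: cols_def)
      then show "v \<in> vec n ` ?R" using col row_in_row_span[of j "{..<n}" f] by auto
    qed
    ultimately show "span ?C \<subseteq> vec n ` ?R" by (intro span_is_subset)
    have "?R \<subseteq> {w. vec n w \<in> span ?C}"
    proof (rule row_span_subsetI)
      show "add_closed {w. vec n w \<in> span ?C}"
        unfolding add_closed_def
      proof (intro conjI ballI; clarify)
        have "vec n (\<lambda>_. 0 :: bit) = \<zero>\<^bsub>V\<^esub>" by (auto simp: module_vec_simps)
        then show "vec n (\<lambda>_. 0) \<in> span ?C"
          using LinearCombinations.submodule.zero_closed[OF sub] by simp
        show "vec n (\<lambda>y. u y + v y) \<in> span ?C" if "vec n u \<in> span ?C" "vec n v \<in> span ?C" for u v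
        proof -
          have "vec n (\<lambda>y. u y + v y) = vec n u \<oplus>\<^bsub>V\<^esub> vec n v" by (auto simp: module_vec_simps)
          then show ?thesis using LinearCombinations.submodule.m_closed[OF sub that] by simp
        qed
      qed
      fix j assume "j \<in> {..<n}"
      then have "j < n" by simp
      then have "col A j \<in> ?C" using A by (auto simp: cols_def)
      then show "(\<lambda>i. if i \<in> {..<n} then f j i else 0) \<in> {w. vec n w \<in> span ?C}"
        using CW col[OF \<open>j < n\<close>] by auto
    qed
    then show "vec n ` ?R \<subseteq> span ?C" by blast
  qed
  \<comment> \<open>\<open>vec n\<close> forgets the values from \<open>n\<close> on, but these are
    0 throughout \<open>row_span\<close>.\<close>
  moreover have "inj_on (vec n) (row_span {..<n} f)"
  proof (rule inj_onI)
    fix u v assume uv: "u \<in> row_span {..<n} f" "v \<in> row_span {..<n} f" and eq: "vec n u = vec n v"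
    show "u = v"
    proof
      fix i
      show "u i = v i"
        using arg_cong[OF eq, of "\<lambda>w. w $ i"] row_span_outside[OF uv(1), of i] row_span_outside[OF uv(2), of i]
        by (cases "i < n") auto
    qed
  qed
  ultimately show ?thesis by (simp add: card_image A_def)
qed

section \<open>From forms to strongly regular graphs\<close>

lemma sum_chi:
  assumes "finite X"
  shows "(\<Sum>z\<in>X. chi (u z)) = real (card X) - 2 * real (card {z \<in> X. u z = 1})"
proof -
  have "(\<Sum>z\<in>X. chi (u z)) = (\<Sum>z\<in>X. 1 - 2 * of_bool (u z = 1))"
    by (intro sum.cong) (auto simp: chi_def)
  also have "\<dots> = real (card X) - 2 * real (card {z \<in> X. u z = 1})"
    using assms by (simp add: sum_subtractf Int_def flip: sum_distrib_left)
  finally show ?thesis .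
qed

text \<open>For indicators a and b, (1 - 2a)(1 - 2b) = 1 - 2a - 2b + 4ab.\<close>

lemma sum_chi_mult:
  assumes "finite X"
  shows "(\<Sum>z\<in>X. chi (u z) * chi (v z)) = real (card X) - 2 * real (card {z \<in> X. u z = 1})
    - 2 * real (card {z \<in> X. v z = 1}) + 4 * real (card {z \<in> X. u z = 1 \<and> v z = 1})"
proof -
  have "(\<Sum>z\<in>X. chi (u z) * chi (v z)) = (\<Sum>z\<in>X. 1 - 2 * of_bool (u z = 1) - 2 * of_bool (v z = 1)
      + 4 * of_bool (u z = 1 \<and> v z = 1))"
    by (intro sum.cong) (auto simp: chi_def)
  also have "\<dots> = real (card X) - 2 * real (card {z \<in> X. u z = 1})
      - 2 * real (card {z \<in> X. v z = 1}) + 4 * real (card {z \<in> X. u z = 1 \<and> v z = 1})"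
    using assms by (simp add: sum_subtractf sum.distrib Int_def flip: sum_distrib_left)
  finally show ?thesis .
qed

lemma two_rank_form:
  assumes "alternating {..<n} f" "card (row_span {..<n} f) = 4 ^ k"
  shows "two_rank n (\<lambda>x y. f x y = 1) = 2 * k"
proof -
  have "adj_mat_F2 n (\<lambda>x y. f x y = 1) = mat n n (\<lambda>(i, j). f i j)"
    by (auto simp: adj_mat_F2_def)
  then have "2 ^ two_rank n (\<lambda>x y. f x y = 1) = (2::nat) ^ (2 * k)"
    using card_row_span_eq_power_rank[OF assms(1)] assms(2) by (simp add: two_rank_def power_mult)
  then show ?thesis by simp
qed

lemma strongly_regular_form:
  assumes alt: "alternating {..<n} f"
    and deg: "\<And>x. x < n \<Longrightarrow> card {z \<in> {..<n}. f x z = 1} = k"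
    and com: "\<And>x y. x < n \<Longrightarrow> y < n \<Longrightarrow> x \<noteq> y \<Longrightarrow> card {z \<in> {..<n}. f x z = 1 \<and> f y z = 1} = l"
  shows "strongly_regular n (\<lambda>x y. f x y = 1) k l l"
proof -
  have "nbhd n (\<lambda>x y. f x y = 1) x = {z \<in> {..<n}. f x z = 1}" for x
    by (auto simp: nbhd_def)
  moreover have "{z \<in> {..<n}. f x z = 1} \<inter> {z \<in> {..<n}. f y z = 1} = {z \<in> {..<n}. f x z = 1 \<and> f y z = 1}" for x y
    by auto
  ultimately show ?thesis
    using alt deg com by (auto simp: strongly_regular_def simple_graph_def alternating_def)
qed

lemma regular_hadamard_degree:
  assumes f: "regular_hadamard X f c" and x: "x \<in> X"
  shows "2 * real (card {z \<in> X. f x z = 1}) = real (card X) - c"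
  using assms sum_chi[of X "f x"] by (auto simp: regular_hadamard_def)

text \<open>Orthogonality of two rows and their known degrees determine the overlap. Adjacency does
  not enter, so adjacent and non-adjacent pairs have equally many common neighbours.\<close>

lemma regular_hadamard_common:
  assumes f: "regular_hadamard X f c" and xy: "x \<in> X" "y \<in> X" "x \<noteq> y"
  shows "4 * real (card {z \<in> X. f x z = 1 \<and> f y z = 1}) = real (card X) - 2 * c"
  using assms sum_chi_mult[of X "f x" "f y"] regular_hadamard_degree[OF f xy(1)]
    regular_hadamard_degree[OF f xy(2)] by (auto simp: regular_hadamard_def)

lemma row_span_remove:
  assumes X: "finite X" and p: "p \<notin> X" and f0: "\<And>x. x \<in> insert p X \<Longrightarrow> f p x = 0 \<and> f x p = 0"
  shows "row_span (insert p X) f = row_span X f"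
proof
  have row: "(\<lambda>y. if y \<in> insert p X then f x y else 0) = (\<lambda>y. if y \<in> X then f x y else 0)"
    if "x \<in> insert p X" for x
    using f0 p that by auto
  have R: "add_closed (row_span X f)" "add_closed (row_span (insert p X) f)"
    using X by (auto intro: add_closed_row_span)
  show "row_span (insert p X) f \<subseteq> row_span X f"
  proof (rule row_span_subsetI[OF R(1)])
    fix x assume x: "x \<in> insert p X"
    show "(\<lambda>y. if y \<in> insert p X then f x y else 0) \<in> row_span X f"
    proof (cases "x = p")
      case True
      then have "(\<lambda>y. if y \<in> insert p X then f x y else 0) = (\<lambda>_. 0)" using f0 by auto
      then show ?thesis using R(1) by (simp add: add_closed_def)
    next
      case False
      then show ?thesis unfolding row[OF x] using x by (intro row_in_row_span) simp
    qed
  qed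
  show "row_span X f \<subseteq> row_span (insert p X) f"
  proof (rule row_span_subsetI[OF R(2)])
    fix x assume "x \<in> X"
    then have x: "x \<in> insert p X" by simp
    show "(\<lambda>y. if y \<in> X then f x y else 0) \<in> row_span (insert p X) f"
      unfolding row[OF x, symmetric] by (rule row_in_row_span[OF x])
  qed
qed

lemma hadamard_rank_SRG:
  assumes f: "hadamard_rank {..<n} f c k"
    and d: "2 * real d = real n - c" and l: "4 * real l = real n - 2 * c"
  shows "SRG_with_2rank (n, d, l, l) (2 * k + 2)"
proof -
  have R: "regular_hadamard {..<n} f c" and card: "card (row_span {..<n} f) = 4 ^ Suc k"
    using f by (auto simp: hadamard_rank_def)
  then have alt: "alternating {..<n} f" by (simp add: regular_hadamard_def)
  have "strongly_regular n (\<lambda>x y. f x y = 1) d l l"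
  proof (rule strongly_regular_form[OF alt])
    show "card {z \<in> {..<n}. f x z = 1} = d" if "x < n" for x
      using regular_hadamard_degree[OF R, of x] d that by simp
    show "card {z \<in> {..<n}. f x z = 1 \<and> f y z = 1} = l" if "x < n" "y < n" "x \<noteq> y" for x y
      using regular_hadamard_common[OF R, of x y] l that by simp
  qed
  moreover have "two_rank n (\<lambda>x y. f x y = 1) = 2 * k + 2"
    using two_rank_form[OF alt card] by simp
  ultimately show ?thesis unfolding SRG_with_2rank_def by auto
qed

text \<open>The last vertex \<open>n\<close> is isolated by normalising and then deleted; half of
  all signs in every other row are negative because that row is orthogonal to the now constant row
  \<open>n\<close>.\<close>

lemma hadamard_rank_SRG_normalise:
  assumes f: "hadamard_rank {..<Suc n} f c k" and d: "2 * d = Suc n" and l: "4 * l = Suc n"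
  shows "SRG_with_2rank (n, d, l, l) (2 * k)"
proof -
  define g where "g = normalise n f"
  have R: "regular_hadamard {..<Suc n} f c"
    using f by (auto simp: hadamard_rank_def)
  then have alt: "alternating {..<Suc n} f" by (simp add: regular_hadamard_def)
  have alt_g: "alternating {..<n} g"
    using alternating_normalise[OF alt, of n] by (auto simp: alternating_def g_def)
  have g0: "g n x = 0 \<and> g x n = 0" if "x \<in> {..<Suc n}" for x
    using normalise_base[OF alt _ that, of n] by (simp add: g_def)
  have "insert n {..<n} = {..<Suc n}" by auto
  then have "row_span {..<n} g = row_span {..<Suc n} g"
    using row_span_remove[of "{..<n}" n g] g0 by auto
  then have card: "card (row_span {..<n} g) = 4 ^ k"
    using hadamard_rank_normalise[OF f, of n] by (simp add: g_def)
  \<comment> \<open>Normalising multiplies rows and columns of the sign matrix by signs, so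
    orthogonality of rows survives.\<close>
  have chi_g: "chi (g x z) = chi (f n x) * (chi (f x z) * chi (f n z))" for x z
    by (simp add: g_def normalise_def chi_add)
  have orth: "(\<Sum>z<Suc n. chi (f x z) * chi (f y z)) = 0" if "x < Suc n" "y < Suc n" "x \<noteq> y" for x y
    using R that unfolding regular_hadamard_def by blast
  have deg: "card {z \<in> {..<Suc n}. g x z = 1} = d" if "x < n" for x
  proof -
    have "(\<Sum>z<Suc n. chi (g x z)) = chi (f n x) * (\<Sum>z<Suc n. chi (f x z) * chi (f n z))"
      unfolding chi_g sum_distrib_left ..
    also have "\<dots> = 0" using orth[of x n] that by simp
    finally have "2 * card {z \<in> {..<Suc n}. g x z = 1} = Suc n"
      using sum_chi[of "{..<Suc n}" "g x"] by (simp del: sum.lessThan_Suc)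
    then show ?thesis using d by simp
  qed
  have com: "card {z \<in> {..<Suc n}. g x z = 1 \<and> g y z = 1} = l" if "x < n" "y < n" "x \<noteq> y" for x y
  proof -
    have "(\<Sum>z<Suc n. chi (g x z) * chi (g y z)) =
        (\<Sum>z<Suc n. chi (f n x) * chi (f n y) * (chi (f x z) * chi (f y z)))"
    proof (rule sum.cong[OF refl])
      fix z
      have "chi (g x z) * chi (g y z) =
          chi (f n x) * chi (f n y) * (chi (f x z) * chi (f y z)) * (chi (f n z) * chi (f n z))"
        unfolding chi_g by (simp only: ac_simps)
      then show "chi (g x z) * chi (g y z) = chi (f n x) * chi (f n y) * (chi (f x z) * chi (f y z))"
        by simp
    qed
    also have "\<dots> = chi (f n x) * chi (f n y) * (\<Sum>z<Suc n. chi (f x z) * chi (f y z))"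
      unfolding sum_distrib_left ..
    also have "\<dots> = 0" using orth[of x y] that by simp
    finally have "4 * card {z \<in> {..<Suc n}. g x z = 1 \<and> g y z = 1} + Suc n = 4 * d"
      using sum_chi_mult[of "{..<Suc n}" "g x" "g y"] deg[OF that(1)] deg[OF that(2)]
      by (simp del: sum.lessThan_Suc)
    then show ?thesis using d l by simp
  qed
  \<comment> \<open>The deleted vertex is isolated, so counts over \<open>Suc n\<close> vertices are
    counts over \<open>n\<close>.\<close>
  have Suc_n: "{z \<in> {..<n}. g x z = 1 \<and> P z} = {z \<in> {..<Suc n}. g x z = 1 \<and> P z}" if "x < n" for x P
    using g0[of x] that by (auto simp: less_Suc_eq)
  have "strongly_regular n (\<lambda>x y. g x y = 1) d l l"
  proof (rule strongly_regular_form[OF alt_g])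
    show "card {z \<in> {..<n}. g x z = 1} = d" if "x < n" for x
      using deg[OF that] Suc_n[OF that, of "\<lambda>_. True"] by simp
    show "card {z \<in> {..<n}. g x z = 1 \<and> g y z = 1} = l" if "x < n" "y < n" "x \<noteq> y" for x y
      using com[OF that] Suc_n[OF that(1), of "\<lambda>z. g y z = 1"] by simp
  qed
  then show ?thesis using two_rank_form[OF alt_g card] unfolding SRG_with_2rank_def by auto
qed

theorem theorem7p1:
  fixes m :: nat
  assumes "m \<ge> 1"
  shows "(\<forall>r. even r \<and> 2*m \<le> r \<and> r \<le> 2*m + 18 * (m div 3) \<longrightarrow> SRG_with_2rank (P0 m) r)
       \<and> (\<forall>r. even r \<and> 2*m + 2 \<le> r \<and> r \<le> 2*m + 2 + 18 * (m div 3) \<longrightarrow> SRG_with_2rank (Pplus m) r)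
       \<and> (\<forall>r. even r \<and> 2*m + 2 \<le> r \<and> r \<le> 2*m + 2 + 18 * (m div 3) \<longrightarrow> SRG_with_2rank (Pminus m) r)"
proof (intro conjI allI impI; elim conjE)
  \<comment> \<open>Writing \<open>m\<close> as a successor removes the truncated subtractions from
    the exponents.\<close>
  obtain j where m: "m = Suc j" using assms by (cases m) auto
  have exps: "2 * m - 1 = Suc (2 * j)" "2 * m - 2 = 2 * j" "m - 1 = j" by (simp_all add: m)
  have pow: "(4::real) ^ m = 4 * 2 ^ (2 * j)" "(2::nat) ^ (2 * m) = 4 ^ m" "(4::nat) ^ m = 4 * 2 ^ (2 * j)"
    by (simp_all add: m power_mult)
  fix r :: nat
  assume "even r"
  {
    assume r: "2 * m \<le> r" "r \<le> 2 * m + 18 * (m div 3)"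
    obtain k where k: "r = 2 * k" using \<open>even r\<close> by auto
    then have "realisable m 1 k" using r assms by (intro realisable) auto
    then obtain f where "hadamard_rank {..<4 ^ m :: nat} f (2 ^ m) k" by (auto simp: realisable_def)
    \<comment> \<open>The vertex to be deleted is the last one, \<open>4 ^ m - 1\<close>.\<close>
    then have "hadamard_rank {..<Suc (4 ^ m - 1)} f (2 ^ m) k" by simp
    then show "SRG_with_2rank (P0 m) r"
      unfolding P0_def pow(2) k exps by (rule hadamard_rank_SRG_normalise) (simp_all add: pow(3))
  next
    assume r: "2 * m + 2 \<le> r" "r \<le> 2 * m + 2 + 18 * (m div 3)"
    obtain i where "r = 2 * i" using \<open>even r\<close> by auto
    then obtain k where k: "r = 2 * k + 2" using r by (cases i) auto
    have *: "realisable m \<epsilon> k" if "\<epsilon> \<in> {1, - 1}" for \<epsilon> using r k assms that by (intro realisable) auto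
    {
      \<comment> \<open>A negative row sum gives the larger degree, half of
        \<open>4 ^ m + 2 ^ m\<close>, hence \<open>Pplus\<close>.\<close>
      obtain f where f: "hadamard_rank {..<4 ^ m :: nat} f (- 1 * 2 ^ m) k"
        using *[of "- 1"] unfolding realisable_def by blast
      show "SRG_with_2rank (Pplus m) r"
        unfolding Pplus_def pow(2) k exps
        by (rule hadamard_rank_SRG[OF f]) (simp_all add: pow(1), simp_all add: m)
    next
      obtain f where f: "hadamard_rank {..<4 ^ m :: nat} f (1 * 2 ^ m) k"
        using *[of 1] unfolding realisable_def by blast
      \<comment> \<open>These bounds make the natural-number differences in \<open>Pminus\<close>
        exact, so that they carry over to the reals.\<close>
      have le: "(2::nat) ^ j \<le> 2 ^ (2 * j)" "(2::nat) ^ j \<le> 2 ^ Suc (2 * j)"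
        by (rule power_increasing; simp)+
      show "SRG_with_2rank (Pminus m) r"
        unfolding Pminus_def pow(2) k exps
        by (rule hadamard_rank_SRG[OF f]) (use le in \<open>simp_all add: pow(1) of_nat_diff del: power_Suc\<close>, simp_all add: m)
    }
  }
qed

end
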